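(* As $n\to\infty$, $$g(n,K_3,P_6)=(1+o(1))\frac{n}{2},$$ where $P_6$ is the path on $6$ vertices.
   Context: Constructor-Blocker game: given graphs $H$ and $F$, two players, Constructor and Blocker, alternately claim previously unclaimed edges of the complete graph $K_n$, Constructor moving first. Constructor may only claim an edge if her graph (the edges she has claimed) remains $F$-free (contains no subgraph isomorphic to $F$); Blocker may claim any unclaimed edge. The game ends when Constructor cannot claim any more edges or all edges are claimed. The score is the number of copies of $H$ in Constructor's graph at the end. Constructor maximizes, Blocker minimizes; $g(n,H,F)$ denotes the score under optimal play by both. *)

theory Defs
  imports Main "HOL-Library.Landau_Symbols"
begin

text \<open>Graphs on vertex set {0..<n} are represented by their edge sets: sets of
  two-element subsets of nat.\<close>

definition edges_K :: "nat \<Rightarrow> nat set set" where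
  "edges_K n = {e. \<exists>u v. u < n \<and> v < n \<and> u \<noteq> v \<and> e = {u, v}}"

definition contains_copy :: "nat set \<times> nat set set \<Rightarrow> nat set set \<Rightarrow> bool" where
  "contains_copy F G \<longleftrightarrow> (\<exists>f. inj_on f (fst F) \<and> (\<forall>e\<in>snd F. f ` e \<in> G))"

definition path_graph :: "nat \<Rightarrow> nat set \<times> nat set set" where
  "path_graph k = ({0..<k}, {{i, Suc i} | i. Suc i < k})"

definition num_triangles :: "nat \<Rightarrow> nat set set \<Rightarrow> nat" where
  "num_triangles n C = card {T. T \<subseteq> {0..<n} \<and> card T = 3 \<and>
       (\<forall>u\<in>T. \<forall>v\<in>T. u \<noteq> v \<longrightarrow> {u, v} \<in> C)}"

definition constr_moves :: "nat \<Rightarrow> nat set set \<Rightarrow> nat set set \<Rightarrow> nat set set" where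
  "constr_moves n C B = {e \<in> edges_K n - (C \<union> B).
       \<not> contains_copy (path_graph 6) (insert e C)}"

text \<open>Value of the game (under optimal play) from position (C, B), where
  Constructor is to move iff the flag is True; the first argument is fuel
  (an upper bound on the number of remaining moves).  The game ends when
  Constructor has no legal move or all edges are claimed.\<close>
fun game_val :: "nat \<Rightarrow> nat \<Rightarrow> nat set set \<Rightarrow> nat set set \<Rightarrow> bool \<Rightarrow> nat" where
  "game_val 0 n C B t = num_triangles n C"
| "game_val (Suc k) n C B t =
     (if constr_moves n C B = {} \<or> edges_K n - (C \<union> B) = {} then num_triangles n C
      else if t then Max ((\<lambda>e. game_val k n (insert e C) B False) ` constr_moves n C B)
      else Min ((\<lambda>e. game_val k n C (insert e B) True) ` (edges_K n - (C \<union> B))))"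

text \<open>g(n, K3, P6): every move claims a new edge, so card (edges_K n) fuel suffices.\<close>
definition g_K3_P6 :: "nat \<Rightarrow> nat" where
  "g_K3_P6 n = game_val (card (edges_K n)) n {} {} True"

end

theory Submission
  imports Defs "HOL-Real_Asymp.Real_Asymp"
begin

text \<open>
  \<^emph>\<open>Upper bound.\<close> Blocker always answers inside the component of Constructor's graph that was just
  enlarged, and keeps the number of triangles in every component \<open>K\<close> at most \<open>|K| / 2\<close>. In components with at
  most five vertices it suffices that the players own about equally many edges. A \<open>P\<^sub>6\<close>-free component
  without 4-cycle is harmless: its triangles share a vertex and are otherwise disjoint. A \<open>P\<^sub>6\<close>-free
  component with a 4-cycle and at least six vertices is essentially a book, i.e. a set of triangles over
  a common spine \<open>uv\<close>, with pendant edges at \<open>u\<close> and \<open>v\<close>. Blocker takes \<open>uv\<close> if he can; otherwise he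
  answers \<open>ux\<close> by \<open>vx\<close> and vice versa, and at most half of the vertices become pages. For the count to
  be right when the book appears, he takes care beforehand that almost every vertex of a component
  is incident to one of his own edges inside the component.

  \<^emph>\<open>Lower bound.\<close> Constructor fixes \<open>q\<close> centers and joins each other vertex to some center as long as
  she can; Blocker needs \<open>q\<close> edges to isolate a vertex from the centers, so he manages this for at most
  \<open>2n / q\<close> vertices. Then she matches leaves of the same center, each time closing a triangle. When she is
  stuck, the unmatched leaves of each center form a clique of Blocker, so there are \<open>O(\<surd>n)\<close> of
  them. The choice \<open>q \<approx> n\<^bsup>1/4\<^esup>\<close> gives \<open>n / 2 - o(n)\<close> triangles.
\<close>

section \<open>Graphs as edge sets\<close>

definition adj :: "nat set set \<Rightarrow> nat \<Rightarrow> nat \<Rightarrow> bool" where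
  "adj C x y \<longleftrightarrow> {x, y} \<in> C"

abbreviation P6_free :: "nat set set \<Rightarrow> bool" where
  "P6_free C \<equiv> \<not> contains_copy (path_graph 6) C"

lemma adj_commute: "adj C x y = adj C y x"
  by (simp add: adj_def insert_commute)

lemma adj_insert: "adj (insert {a, b} C) x y \<longleftrightarrow> x = a \<and> y = b \<or> x = b \<and> y = a \<or> adj C x y"
  by (auto simp: adj_def doubleton_eq_iff)

lemma adj_irrefl: "C \<subseteq> edges_K n \<Longrightarrow> \<not> adj C x x"
  by (auto simp: adj_def edges_K_def)

lemma adj_less: "C \<subseteq> edges_K n \<Longrightarrow> adj C x y \<Longrightarrow> x < n \<and> y < n"
  by (auto simp: adj_def edges_K_def doubleton_eq_iff)

lemma finite_edges_K [simp]: "finite (edges_K n)"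
  by (rule finite_subset[of _ "Pow {..<n}"]) (auto simp: edges_K_def)

lemma contains_P6_iff:
  "contains_copy (path_graph 6) C \<longleftrightarrow>
    (\<exists>a b c d e f. distinct [a, b, c, d, e, f] \<and>
      adj C a b \<and> adj C b c \<and> adj C c d \<and> adj C d e \<and> adj C e f)"
proof
  assume "contains_copy (path_graph 6) C"
  then obtain f where inj: "inj_on f {0..<6}"
    and E': "\<forall>e\<in>{{i, Suc i} |i. Suc i < 6}. f ` e \<in> C"
    unfolding contains_copy_def path_graph_def fst_conv snd_conv by blast
  have E: "f ` {i, Suc i} \<in> C" if "Suc i < 6" for i
    using E' that by blast
  have "distinct (map f [0, 1, 2, 3, 4, 5])"
    unfolding distinct_map by (intro conjI inj_on_subset[OF inj]) auto
  moreover have "adj C (f 0) (f 1)" "adj C (f 1) (f 2)" "adj C (f 2) (f 3)" "adj C (f 3) (f 4)" "adj C (f 4) (f 5)"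
    using E[of 0] E[of 1] E[of 2] E[of 3] E[of 4] by (simp_all add: adj_def numeral_eq_Suc)
  ultimately show "\<exists>a b c d e f. distinct [a, b, c, d, e, f] \<and>
      adj C a b \<and> adj C b c \<and> adj C c d \<and> adj C d e \<and> adj C e f"
    unfolding list.map by blast
next
  assume "\<exists>a b c d e f. distinct [a, b, c, d, e, f] \<and>
      adj C a b \<and> adj C b c \<and> adj C c d \<and> adj C d e \<and> adj C e f"
  then obtain a b c d e f where D: "distinct [a, b, c, d, e, f]" and
    E: "adj C a b" "adj C b c" "adj C c d" "adj C d e" "adj C e f" by blast
  let ?g = "(!) [a, b, c, d, e, f]"
  have "inj_on ?g {0..<6}"
    using D by (intro inj_on_nth) auto
  moreover have "?g ` {i, Suc i} \<in> C" if "Suc i < 6" for i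
  proof -
    have "i = 0 \<or> i = 1 \<or> i = 2 \<or> i = 3 \<or> i = 4" using that by linarith
    then show ?thesis using E unfolding adj_def by (elim disjE) (simp_all add: numeral_eq_Suc)
  qed
  ultimately show "contains_copy (path_graph 6) C"
    by (auto simp: contains_copy_def path_graph_def intro!: exI[of _ ?g])
qed

lemma P6_freeD:
  assumes "P6_free C" "adj C a b" "adj C b c" "adj C c d" "adj C d e" "adj C e f"
  shows "\<not> distinct [a, b, c, d, e, f]"
  using assms unfolding contains_P6_iff by blast

section \<open>Components\<close>

definition closed_under :: "nat set set \<Rightarrow> nat set \<Rightarrow> bool" where
  "closed_under C S \<longleftrightarrow> (\<forall>a\<in>S. \<forall>b. adj C a b \<longrightarrow> b \<in> S)"

text \<open>Encoded as minimal nonempty closed sets rather than classes of a reachability relation,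
  so that connectivity is used through cuts and no walks appear. Every natural number lies in such a
  set; numbers that touch no edge form singletons.\<close>

definition component :: "nat set set \<Rightarrow> nat set \<Rightarrow> bool" where
  "component C K \<longleftrightarrow> K \<noteq> {} \<and> closed_under C K \<and>
     (\<forall>S\<subseteq>K. S \<noteq> {} \<longrightarrow> closed_under C S \<longrightarrow> S = K)"

lemma component_closed: "component C K \<Longrightarrow> a \<in> K \<Longrightarrow> adj C a b \<Longrightarrow> b \<in> K"
  by (auto simp: component_def closed_under_def)

lemma component_minimal:
  "component C K \<Longrightarrow> S \<subseteq> K \<Longrightarrow> S \<noteq> {} \<Longrightarrow> closed_under C S \<Longrightarrow> S = K"
  unfolding component_def by blast

lemma closed_under_Int: "closed_under C S \<Longrightarrow> closed_under C T \<Longrightarrow> closed_under C (S \<inter> T)"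
  unfolding closed_under_def by blast

lemma closed_under_component: "component C K \<Longrightarrow> closed_under C K"
  by (simp add: component_def)

text \<open>Connectivity enters mostly in this form: applied to the vertices of a cycle, or to a
  ball around a triangle, it supplies an attached vertex.\<close>

lemma component_cut:
  assumes "component C K" "S \<subseteq> K" "S \<noteq> {}" "S \<noteq> K"
  obtains a b where "a \<in> S" "b \<in> K - S" "adj C a b"
proof -
  have "\<not> closed_under C S" using assms by (auto simp: component_def)
  then obtain a b where "a \<in> S" "adj C a b" "b \<notin> S" by (auto simp: closed_under_def)
  moreover have "b \<in> K" using component_closed[OF assms(1)] assms(2) calculation by blast
  ultimately show ?thesis using that by blast
qed

lemma component_exists: "\<exists>K. component C K \<and> x \<in> K"
proof -
  define K where "K = \<Inter>{S. closed_under C S \<and> x \<in> S}"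
  have cl: "closed_under C K" unfolding K_def closed_under_def by blast
  have x: "x \<in> K" by (auto simp: K_def)
  have "S = K" if S: "S \<subseteq> K" "S \<noteq> {}" "closed_under C S" for S
  proof (cases "x \<in> S")
    case True
    then show ?thesis using S by (auto simp: K_def)
  next
    case False
    \<comment> \<open>By symmetry of adjacency no edge joins \<open>S\<close> to its complement, so
      the part of \<open>K\<close> outside \<open>S\<close> would be a smaller closed set around
      \<open>x\<close>.\<close>
    have "closed_under C (K - S)"
      using cl S(3) unfolding closed_under_def by (metis Diff_iff adj_commute)
    then have "K \<subseteq> K - S" using False x by (auto simp: K_def)
    then show ?thesis using S by blast
  qed
  then show ?thesis using cl x unfolding component_def by blast
qed

lemma component_unique:
  assumes "component C K" "component C L" "x \<in> K" "x \<in> L"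
  shows "K = L"
proof -
  have cl: "closed_under C (K \<inter> L)"
    using assms(1,2) by (intro closed_under_Int closed_under_component)
  have ne: "K \<inter> L \<noteq> {}" using assms(3,4) by blast
  show ?thesis
    using component_minimal[OF assms(1) _ ne cl] component_minimal[OF assms(2) _ ne cl] by blast
qed

lemma component_finite:
  assumes "C \<subseteq> edges_K n" "component C K"
  shows "finite K" "x \<in> K \<Longrightarrow> x < n \<Longrightarrow> K \<subseteq> {0..<n}"
proof -
  have *: "K \<subseteq> {0..<n}" if "x \<in> K" "x < n" for x
  proof -
    have "closed_under C (K \<inter> {0..<n})"
      using assms(2) adj_less[OF assms(1)] unfolding component_def closed_under_def
      by (metis Int_iff atLeastLessThan_iff zero_le)
    then have "K \<inter> {0..<n} = K" using assms(2) that unfolding component_def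
      by (metis Int_iff Int_lower1 atLeastLessThan_iff empty_iff zero_le)
    then show ?thesis by blast
  qed
  then show "x \<in> K \<Longrightarrow> x < n \<Longrightarrow> K \<subseteq> {0..<n}" by blast
  show "finite K"
  proof (cases "\<exists>x\<in>K. x < n")
    case True
    then show ?thesis using * finite_subset by blast
  next
    case False
    obtain x where "x \<in> K" using assms(2) by (auto simp: component_def)
    moreover have "closed_under C {x}"
      using False calculation adj_less[OF assms(1)] unfolding closed_under_def by blast
    ultimately have "{x} = K" using assms(2) unfolding component_def by blast
    then show ?thesis by auto
  qed
qed

text \<open>The case \<open>K = L\<close> is allowed, so this treats both a merge of two components
  and an edge inside one.\<close>

lemma component_insert:
  assumes "component C K" "component C L" "x \<in> K" "y \<in> L"
  shows "component (insert {x, y} C) (K \<union> L)"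
proof -
  let ?C = "insert {x, y} C"
  have "closed_under ?C (K \<union> L)"
    using assms by (auto simp: component_def closed_under_def adj_insert)
  moreover have "S = K \<union> L" if S: "S \<subseteq> K \<union> L" "S \<noteq> {}" "closed_under ?C S" for S
  proof -
    have "closed_under C S"
      using S(3) by (simp add: closed_under_def adj_insert)
    then have "closed_under C (S \<inter> K)" "closed_under C (S \<inter> L)"
      using assms by (simp_all add: closed_under_Int closed_under_component)
    then have "S \<inter> K = {} \<or> S \<inter> K = K" "S \<inter> L = {} \<or> S \<inter> L = L"
      using component_minimal[OF assms(1) Int_lower2] component_minimal[OF assms(2) Int_lower2] by metis+
    moreover have "x \<in> S \<longleftrightarrow> y \<in> S"
      using S(3) by (auto simp: closed_under_def adj_insert)
    ultimately show ?thesis using S assms by blast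
  qed
  ultimately show ?thesis using assms unfolding component_def by blast
qed

lemma component_insert_other:
  assumes "component (insert {x, y} C) K" "x \<notin> K"
  shows "component C K" "y \<notin> K"
proof -
  show y: "y \<notin> K" using assms component_closed[OF assms(1), of y x] by (auto simp: adj_insert)
  have "closed_under (insert {x, y} C) S" if "S \<subseteq> K" "closed_under C S" for S
    using that y assms by (auto simp: closed_under_def adj_insert)
  moreover have "closed_under C K" using assms by (auto simp: component_def closed_under_def adj_insert)
  ultimately show "component C K" using assms unfolding component_def by auto
qed

section \<open>Books and 4-cycles in \<open>P\<^sub>6\<close>-free graphs\<close>

text \<open>A sixth vertex of the component yields some \<open>w\<close> attached to the cycle;
  entering the cycle from \<open>w\<close> and running all the way around gives a path on six
  vertices.\<close>

lemma no_spanned_5_cycle: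
  assumes K: "component C K" "card K \<ge> 6" and free: "P6_free C"
    and D: "distinct [a, b, c, d, e]" "a \<in> K"
    and E: "adj C a b" "adj C b c" "adj C c d" "adj C d e" "adj C e a"
  shows False
proof -
  let ?S = "{a, b, c, d, e}"
  have "card ?S \<le> 5" using card_length[of "[a, b, c, d, e]"] by simp
  then have ne: "?S \<noteq> K" using K(2) by auto
  have "b \<in> K" "c \<in> K" "d \<in> K" "e \<in> K"
    using component_closed[OF K(1)] D(2) E by blast+
  then have "?S \<subseteq> K" using D(2) by blast
  then obtain s w where s: "s \<in> ?S" and w: "w \<notin> ?S" "adj C w s"
    using component_cut[OF K(1), of ?S] ne by (metis DiffE adj_commute insert_not_empty)
  from s consider "s = a" | "s = b" | "s = c" | "s = d" | "s = e" by blast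
  then show False
  proof cases
    case 1
    then show ?thesis using P6_freeD[OF free, of w a b c d e] w D E by auto
  next
    case 2
    then show ?thesis using P6_freeD[OF free, of w b c d e a] w D E by auto
  next
    case 3
    then show ?thesis using P6_freeD[OF free, of w c d e a b] w D E by auto
  next
    case 4
    then show ?thesis using P6_freeD[OF free, of w d e a b c] w D E by auto
  next
    case 5
    then show ?thesis using P6_freeD[OF free, of w e a b c d] w D E by auto
  qed
qed

definition pages :: "nat set set \<Rightarrow> nat set \<Rightarrow> nat \<Rightarrow> nat \<Rightarrow> nat set" where
  "pages C K u v = {x \<in> K. adj C u x \<and> adj C v x}"

text \<open>The shape of a large component containing a 4-cycle: a book with spine \<open>uv\<close> (where \<open>uv\<close> itself
  need not be an edge) with pendant edges at \<open>u\<close> and \<open>v\<close>, and possibly an edge joining the pages if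
  there are only two.\<close>

definition spine :: "nat set set \<Rightarrow> nat set \<Rightarrow> nat \<Rightarrow> nat \<Rightarrow> bool" where
  "spine C K u v \<longleftrightarrow> u \<in> K \<and> v \<in> K \<and> u \<noteq> v \<and>
     (\<forall>y\<in>K - {u, v}. adj C u y \<or> adj C v y) \<and>
     (\<forall>y\<in>K - {u, v}. \<forall>z\<in>K - {u, v}. adj C y z \<longrightarrow> pages C K u v = {y, z}) \<and>
     (\<exists>x\<in>pages C K u v. \<exists>y\<in>pages C K u v. x \<noteq> y)"

lemma pages_commute: "pages C K u v = pages C K v u"
  by (auto simp: pages_def)

lemma spine_commute: "spine C K u v \<longleftrightarrow> spine C K v u"
  unfolding spine_def pages_commute[of C K u v] by (simp add: insert_commute) blast

text \<open>The edge \<open>tu\<close> forces the opposite vertices \<open>u\<close> and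
  \<open>v\<close> to be the spine. A neighbour \<open>s\<close> of \<open>u\<close> off the cycle
  has no neighbours except \<open>u\<close> and \<open>v\<close>: \<open>x1\<close> or
  \<open>x2\<close> would give a 5-cycle, and a vertex \<open>z\<close> off the cycle would give the
  path \<open>z s u x1 v x2\<close>. The same holds at \<open>v\<close>. An outer neighbour
  \<open>b\<close> of \<open>x1\<close> would give the path \<open>b x1 v x2 u t\<close>, and
  similarly for \<open>x2\<close>.\<close>

lemma spine_if_attached:
  assumes K: "component C K" "card K \<ge> 6" and free: "P6_free C"
    and D: "distinct [u, x1, v, x2]" "u \<in> K" and irr: "\<And>x. \<not> adj C x x"
    and E: "adj C u x1" "adj C x1 v" "adj C v x2" "adj C x2 u"
    and t: "t \<notin> {u, x1, v, x2}" "adj C t u"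
  shows "spine C K u v" and "x1 \<in> pages C K u v" and "x2 \<in> pages C K u v"
proof -
  have E': "adj C x1 u" "adj C v x1" "adj C x2 v" "adj C u x2" "adj C u t"
    using E t by (simp_all add: adj_commute)
  have inK: "x1 \<in> K" "v \<in> K" "x2 \<in> K" "t \<in> K"
    using component_closed[OF K(1)] D(2) E E' by blast+
  have nbr_u: "z = u \<or> z = v" if "s \<notin> {u, x1, v, x2}" "adj C s u" "adj C s z" for s z
  proof (rule ccontr)
    assume n: "\<not> (z = u \<or> z = v)"
    have su: "adj C u s" using that(2) by (simp add: adj_commute)
    consider "z = x1" | "z = x2" | "z \<notin> {u, x1, v, x2}" using n by blast
    then show False
    proof cases
      case 1
      then show ?thesis
        using no_spanned_5_cycle[OF K free, of u x2 v x1 s] that n D E E' su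
        by (auto simp: adj_commute)
    next
      case 2
      then show ?thesis
        using no_spanned_5_cycle[OF K free, of u x1 v x2 s] that n D E E' su
        by (auto simp: adj_commute)
    next
      case 3
      have "z \<noteq> s" using that(3) irr by blast
      moreover have "adj C z s" using that(3) by (simp add: adj_commute)
      ultimately show ?thesis
        using P6_freeD[OF free, of z s u x1 v x2] that 3 D E by auto
    qed
  qed
  have nbr_v: "z = u \<or> z = v" if "s \<notin> {u, x1, v, x2}" "adj C s v" "adj C s z" for s z
  proof (rule ccontr)
    assume n: "\<not> (z = u \<or> z = v)"
    have sv: "adj C v s" using that(2) by (simp add: adj_commute)
    consider "z = x1" | "z = x2" | "z \<notin> {u, x1, v, x2}" using n by blast
    then show False
    proof cases
      case 1
      then show ?thesis
        using no_spanned_5_cycle[OF K free, of v x2 u x1 s] inK that n D E E' sv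
        by (auto simp: adj_commute)
    next
      case 2
      then show ?thesis
        using no_spanned_5_cycle[OF K free, of v x1 u x2 s] inK that n D E E' sv
        by (auto simp: adj_commute)
    next
      case 3
      have "z \<noteq> s" using that(3) irr by blast
      moreover have "adj C z s" using that(3) by (simp add: adj_commute)
      ultimately show ?thesis
        using P6_freeD[OF free, of z s v x1 u x2] that 3 D E E' by auto
    qed
  qed
  have x_out: "b = u \<or> b = v" if "a = x1 \<and> b \<noteq> x2 \<or> a = x2 \<and> b \<noteq> x1" "adj C a b" for a b
  proof (rule ccontr)
    assume n: "\<not> (b = u \<or> b = v)"
    have ba: "adj C b a" using that(2) by (simp add: adj_commute)
    have b: "b \<notin> {u, x1, v, x2}" using n that irr by blast
    have "b \<noteq> t" using nbr_u[OF b] ba n that t b D by auto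
    then show False
      using P6_freeD[OF free, of b x1 v x2 u t] P6_freeD[OF free, of b x2 v x1 u t]
        that b ba D E E' t by auto
  qed
  \<comment> \<open>The cycle together with all neighbours of \<open>u\<close> and \<open>v\<close>;
    the restrictions just shown leave no edge out of this set.\<close>
  define S where "S = {u, x1, v, x2} \<union> {s \<in> K. adj C s u \<or> adj C s v}"
  have S: "S = K"
  proof (rule ccontr)
    assume "S \<noteq> K"
    moreover have "S \<subseteq> K" "S \<noteq> {}" using D inK by (auto simp: S_def)
    ultimately obtain a b where ab: "a \<in> S" "b \<in> K" "b \<notin> S" "adj C a b"
      using component_cut[OF K(1), of S] by (metis DiffE)
    have "a \<noteq> u" "a \<noteq> v" using ab by (auto simp: S_def adj_commute)
    then show False using ab x_out[of a b] nbr_u[of a b] nbr_v[of a b] by (auto simp: S_def)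
  qed
  show x1: "x1 \<in> pages C K u v" and x2: "x2 \<in> pages C K u v"
    using inK E E' by (auto simp: pages_def)
  have dom: "adj C u y \<or> adj C v y" if "y \<in> K - {u, v}" for y
    using that S E E' by (auto simp: S_def adj_commute)
  have "pages C K u v = {y, z}" if "y \<in> K - {u, v}" "z \<in> K - {u, v}" "adj C y z" for y z
  proof -
    have "y \<in> {u, x1, v, x2}"
      using dom[OF that(1)] nbr_u[of y z] nbr_v[of y z] that by (auto simp: adj_commute)
    then have yz: "y = x1 \<and> z = x2 \<or> y = x2 \<and> z = x1"
      using x_out[of y z] that by auto
    then have xx: "adj C x1 x2" using that(3) by (auto simp: adj_commute)
    \<comment> \<open>Next to the edge \<open>x1 x2\<close>, a third page \<open>p\<close> would
      close the 5-cycle \<open>x1 x2 u p v\<close>.\<close>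
    have "p = x1 \<or> p = x2" if "p \<in> pages C K u v" for p
    proof (rule ccontr)
      assume "\<not> (p = x1 \<or> p = x2)"
      moreover have "p \<in> K" "adj C u p" "adj C v p" using that by (auto simp: pages_def)
      moreover from this have "p \<noteq> u" "p \<noteq> v" using irr by auto
      moreover have "adj C p v" using \<open>adj C v p\<close> by (simp add: adj_commute)
      ultimately show False
        using no_spanned_5_cycle[OF K free, of x1 x2 u p v] xx inK D E E' by auto
    qed
    then have "pages C K u v = {x1, x2}" using x1 x2 by blast
    then show ?thesis using yz by blast
  qed
  then show "spine C K u v" unfolding spine_def using D inK dom x1 x2 by auto
qed

definition C4_in :: "nat set set \<Rightarrow> nat set \<Rightarrow> bool" where
  "C4_in C K \<longleftrightarrow> (\<exists>a\<in>K. \<exists>b\<in>K. \<exists>c\<in>K. \<exists>d\<in>K. distinct [a, b, c, d] \<and>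
     adj C a b \<and> adj C b c \<and> adj C c d \<and> adj C d a)"

lemma C4_inI:
  assumes "a \<in> K" "b \<in> K" "c \<in> K" "d \<in> K" "distinct [a, b, c, d]"
    "adj C a b" "adj C b c" "adj C c d" "adj C d a"
  shows "C4_in C K"
  using assms unfolding C4_in_def by blast

text \<open>Rotating the cycle puts the attached vertex first. Two graphs occur because the cycle
  may have to come from the component before a move, while the attached vertex may arrive only with
  the move.\<close>

lemma C4_attached:
  assumes K: "component D K" "card K > 4" and C4: "C4_in C M" and sub: "C \<subseteq> D" "M \<subseteq> K"
  obtains u x1 v x2 t where "distinct [u, x1, v, x2]" "u \<in> M" "x1 \<in> M" "v \<in> M" "x2 \<in> M" "t \<in> K"
    "adj C u x1" "adj C x1 v" "adj C v x2" "adj C x2 u" "t \<notin> {u, x1, v, x2}" "adj D t u"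
proof -
  obtain a b c d where in_M: "a \<in> M" "b \<in> M" "c \<in> M" "d \<in> M" and D: "distinct [a, b, c, d]"
    and E: "adj C a b" "adj C b c" "adj C c d" "adj C d a"
    using C4 unfolding C4_in_def by blast
  let ?S = "{a, b, c, d}"
  have "card ?S \<le> 4" using card_length[of "[a, b, c, d]"] by simp
  then have "?S \<noteq> K" using K(2) by auto
  moreover have "?S \<subseteq> K" using in_M sub(2) by blast
  ultimately obtain s t where s: "s \<in> ?S" and t: "t \<notin> ?S" "adj D t s" "t \<in> K"
    using component_cut[OF K(1), of ?S] by (metis DiffE adj_commute insert_not_empty)
  from s consider "s = a" | "s = b" | "s = c" | "s = d" by blast
  then show ?thesis
  proof cases
    case 1 then show ?thesis using that[of a b c d t] in_M D E t by simp
  next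
    case 2 then show ?thesis using that[of b c d a t] in_M D E t by auto
  next
    case 3 then show ?thesis using that[of c d a b t] in_M D E t by auto
  next
    case 4 then show ?thesis using that[of d a b c t] in_M D E t by auto
  qed
qed

section \<open>Counting triangles in a component\<close>

definition triangles :: "nat set set \<Rightarrow> nat set \<Rightarrow> nat set set" where
  "triangles C K = {T. T \<subseteq> K \<and> card T = 3 \<and> (\<forall>u\<in>T. \<forall>v\<in>T. u \<noteq> v \<longrightarrow> adj C u v)}"

lemma finite_triangles: "finite K \<Longrightarrow> finite (triangles C K)"
  by (rule finite_subset[of _ "Pow K"]) (auto simp: triangles_def)

lemma triangle_third:
  assumes "T \<in> triangles C K" "a \<in> T" "b \<in> T" "a \<noteq> b"
  obtains c where "T = {a, b, c}" "c \<noteq> a" "c \<noteq> b" "adj C a b" "adj C a c" "adj C b c"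
proof -
  have T: "card T = 3" "\<And>u v. u \<in> T \<Longrightarrow> v \<in> T \<Longrightarrow> u \<noteq> v \<Longrightarrow> adj C u v"
    using assms(1) by (auto simp: triangles_def)
  obtain x y z where xyz: "T = {x, y, z}" "x \<noteq> y" "y \<noteq> z" "x \<noteq> z"
    using T(1) unfolding card_3_iff by blast
  then have "\<exists>c. T = {a, b, c} \<and> c \<noteq> a \<and> c \<noteq> b" using assms by auto
  then obtain c where c: "T = {a, b, c}" "c \<noteq> a" "c \<noteq> b" by blast
  show ?thesis by (rule that[OF c]) (use T(2) c assms in auto)
qed

lemma triangle_others:
  assumes "T \<in> triangles C K" "a \<in> T"
  obtains b c where "T = {a, b, c}" "b \<noteq> a" "c \<noteq> a" "c \<noteq> b" "adj C a b" "adj C a c" "adj C b c"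
proof -
  have "T \<noteq> {a}" using assms by (auto simp: triangles_def)
  then obtain b where "b \<in> T" "a \<noteq> b" using assms(2) by blast
  then show ?thesis using triangle_third[OF assms] that by metis
qed

text \<open>Disjoint triangles in a connected graph are joined by a path, and walking through both
  triangles makes it too long. An edge between them already gives six vertices (\<open>p1\<close>),
  and so does a path of three further vertices leaving \<open>T1\<close>
  (\<open>p3\<close>).\<close>

lemma triangles_intersect:
  assumes K: "component C K" and free: "P6_free C" and irr: "\<And>x. \<not> adj C x x"
    and T: "T1 \<in> triangles C K" "T2 \<in> triangles C K"
  shows "T1 \<inter> T2 \<noteq> {}"
proof
  assume disj: "T1 \<inter> T2 = {}"
  have sub: "T1 \<subseteq> K" "T2 \<subseteq> K" "T1 \<noteq> {}" "T2 \<noteq> {}" using T by (auto simp: triangles_def)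
  have p1: False if p: "a \<in> T1" "b \<in> T2" "adj C a b" for a b
  proof -
    obtain a' a'' where a: "T1 = {a, a', a''}" "a' \<noteq> a" "a'' \<noteq> a" "a'' \<noteq> a'" "adj C a a'" "adj C a' a''"
      using triangle_others[OF T(1) p(1)] by metis
    obtain b' b'' where b: "T2 = {b, b', b''}" "b' \<noteq> b" "b'' \<noteq> b" "b'' \<noteq> b'" "adj C b b'" "adj C b' b''"
      using triangle_others[OF T(2) p(2)] by metis
    have "adj C a'' a'" "adj C a' a" using a by (simp_all add: adj_commute)
    then show False using P6_freeD[OF free, of a'' a' a b b' b''] a b that disj by auto
  qed
  have p3: False if p: "a \<in> T1" "s \<notin> T1" "adj C a s" "adj C s t" "t \<notin> T1" "adj C t r" "r \<notin> T1" "r \<noteq> s" for a s t r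
  proof -
    obtain a' a'' where a: "T1 = {a, a', a''}" "a' \<noteq> a" "a'' \<noteq> a" "a'' \<noteq> a'" "adj C a a'" "adj C a' a''"
      using triangle_others[OF T(1) p(1)] by metis
    have "adj C a'' a'" "adj C a' a" using a by (simp_all add: adj_commute)
    moreover have "s \<noteq> t" "t \<noteq> r" using that irr by blast+
    ultimately show False using P6_freeD[OF free, of a'' a' a s t r] a that by auto
  qed
  \<comment> \<open>The balls of radius 1 and 2 around \<open>T1\<close>. By \<open>p3\<close>
    nothing lies at distance 3, so \<open>T2\<close> has a vertex \<open>b\<close> at distance 1 or
    2; in the latter case the path continues from \<open>b\<close> inside \<open>T2\<close>.\<close>
  define D1 where "D1 = {s \<in> K. s \<in> T1 \<or> (\<exists>a\<in>T1. adj C a s)}"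
  define D2 where "D2 = D1 \<union> {t \<in> K. \<exists>s\<in>D1. adj C s t}"
  have "D2 = K"
  proof (rule ccontr)
    assume "D2 \<noteq> K"
    moreover have "D2 \<subseteq> K" "D2 \<noteq> {}" using sub by (auto simp: D2_def D1_def)
    ultimately obtain t r where tr: "t \<in> D2" "r \<in> K" "r \<notin> D2" "adj C t r"
      using component_cut[OF K, of D2] by (metis DiffE)
    have "t \<notin> D1" using tr by (auto simp: D2_def)
    then obtain s where s: "s \<in> D1" "adj C s t" "t \<in> K" using tr(1) by (auto simp: D2_def)
    then have "s \<notin> T1" using \<open>t \<notin> D1\<close> by (auto simp: D1_def)
    then obtain a where "a \<in> T1" "adj C a s" using s(1) by (auto simp: D1_def)
    moreover have "r \<notin> T1" "t \<notin> T1" "r \<noteq> s"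
      using tr s \<open>t \<notin> D1\<close> sub by (auto simp: D1_def D2_def)
    ultimately show False using p3[of a s t r] \<open>s \<notin> T1\<close> s tr by blast
  qed
  obtain b where b: "b \<in> T2" using sub by blast
  then have "b \<notin> T1" using disj by blast
  show False
  proof (cases "b \<in> D1")
    case True
    then show ?thesis using p1 b \<open>b \<notin> T1\<close> by (auto simp: D1_def)
  next
    case False
    have "b \<in> D2" using b sub \<open>D2 = K\<close> by blast
    then obtain s where s: "s \<in> D1" "adj C s b" using False by (auto simp: D2_def)
    then have "s \<notin> T1" using p1 b by blast
    then obtain a where a: "a \<in> T1" "adj C a s" using s(1) by (auto simp: D1_def)
    then have "s \<notin> T2" using p1 by blast
    obtain b' where b': "b' \<in> T2" "adj C b b'" using triangle_others[OF T(2) b] by (metis insertCI)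
    then have "b' \<notin> T1" "b' \<noteq> s" using disj \<open>s \<notin> T2\<close> by auto
    then show ?thesis using p3[of a s b b'] a s b b' \<open>s \<notin> T1\<close> \<open>b \<notin> T1\<close> by blast
  qed
qed

text \<open>Without a 4-cycle two triangles share at most one vertex. As any two meet, two or more
  triangles all pass through one vertex \<open>a\<close>, and removing \<open>a\<close> leaves
  disjoint pairs.\<close>

lemma C4_free_triangle_bound:
  assumes K: "component C K" "finite K" and free: "P6_free C" and irr: "\<And>x. \<not> adj C x x"
    and C4: "\<not> C4_in C K"
  shows "2 * card (triangles C K) \<le> card K"
proof -
  let ?T = "triangles C K"
  have fin: "finite ?T" using K(2) by (rule finite_triangles)
  have one: "x = y" if T: "T1 \<in> ?T" "T2 \<in> ?T" "T1 \<noteq> T2" and xy: "x \<in> T1 \<inter> T2" "y \<in> T1 \<inter> T2" for T1 T2 x y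
  proof (rule ccontr)
    assume "x \<noteq> y"
    obtain c where c: "T1 = {x, y, c}" "c \<noteq> x" "c \<noteq> y" "adj C x c" "adj C y c"
      using triangle_third[OF T(1), of x y] xy \<open>x \<noteq> y\<close> by (metis Int_iff)
    obtain d where d: "T2 = {x, y, d}" "d \<noteq> x" "d \<noteq> y" "adj C x d" "adj C y d"
      using triangle_third[OF T(2), of x y] xy \<open>x \<noteq> y\<close> by (metis Int_iff)
    have "c \<noteq> d" using c d that by blast
    moreover have "T1 \<subseteq> K" "T2 \<subseteq> K" using T by (auto simp: triangles_def)
    ultimately have "C4_in C K"
      using c d \<open>x \<noteq> y\<close> by (intro C4_inI[of x _ c y d]) (auto simp: adj_commute)
    then show False using C4 by blast
  qed
  show ?thesis
  proof (cases "card ?T \<le> 1")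
    case True
    show ?thesis
    proof (cases "?T = {}")
      case False
      then obtain T where "T \<in> ?T" by blast
      then have "3 \<le> card K" using card_mono[OF K(2), of T] by (auto simp: triangles_def)
      then show ?thesis using True by linarith
    qed simp
  next
    case False
    obtain T1 T2 where T12: "T1 \<in> ?T" "T2 \<in> ?T" "T1 \<noteq> T2"
      using False by (metis card_le_Suc0_iff_eq fin One_nat_def)
    obtain a where a: "a \<in> T1" "a \<in> T2" using triangles_intersect[OF K(1) free irr T12(1,2)] by blast
    have all: "a \<in> T" if T: "T \<in> ?T" for T
    proof (rule ccontr)
      \<comment> \<open>A triangle avoiding \<open>a\<close> meets \<open>T1\<close> in some
        \<open>b\<close> and \<open>T2\<close> in some \<open>d\<close>; with the third vertex
        \<open>c\<close> of \<open>T1\<close> this produces the 4-cycle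
        \<open>a c b d\<close>.\<close>
      assume n: "a \<notin> T"
      obtain b where b: "b \<in> T" "b \<in> T1" using triangles_intersect[OF K(1) free irr T T12(1)] by blast
      obtain d where d: "d \<in> T" "d \<in> T2" using triangles_intersect[OF K(1) free irr T T12(2)] by blast
      have ne: "a \<noteq> b" "a \<noteq> d" using b d n by auto
      then have "b \<noteq> d" using one[OF T12, of a b] a b d by blast
      obtain c where c: "T1 = {a, b, c}" "c \<noteq> a" "c \<noteq> b" "adj C a c" "adj C b c"
        using triangle_third[OF T12(1), of a b] a b ne by metis
      have "c \<noteq> d" using one[OF T12, of a c] a c d by blast
      have "adj C b d" "adj C a d" using T T12(2) b d a ne \<open>b \<noteq> d\<close> by (auto simp: triangles_def)
      moreover have "T1 \<subseteq> K" "T2 \<subseteq> K" using T12 by (auto simp: triangles_def)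
      ultimately have "C4_in C K"
        using a b c d ne \<open>b \<noteq> d\<close> \<open>c \<noteq> d\<close> by (intro C4_inI[of a _ c b d]) (auto simp: adj_commute)
      then show False using C4 by blast
    qed
    have card2: "card (T - {a}) = 2" if "T \<in> ?T" for T
      using that all[OF that] by (auto simp: triangles_def)
    have "2 * card ?T = (\<Sum>T\<in>?T. card (T - {a}))" using card2 by simp
    also have "\<dots> = card (\<Union>T\<in>?T. T - {a})"
    proof (rule card_UN_disjoint[symmetric, OF fin])
      show "\<forall>T\<in>?T. finite (T - {a})" using card2 by (metis card.infinite zero_neq_numeral)
      show "\<forall>T\<in>?T. \<forall>T'\<in>?T. T \<noteq> T' \<longrightarrow> (T - {a}) \<inter> (T' - {a}) = {}"
      proof (intro ballI impI equals0I)
        fix T T' y assume TT: "T \<in> ?T" "T' \<in> ?T" "T \<noteq> T'" and y: "y \<in> (T - {a}) \<inter> (T' - {a})"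
        have "a \<in> T \<inter> T'" using all TT by blast
        with y show False using one[OF TT, of y a] by blast
      qed
    qed
    also have "\<dots> \<le> card K" using K(2) by (intro card_mono) (auto simp: triangles_def)
    finally show ?thesis .
  qed
qed

definition edges_in :: "nat set set \<Rightarrow> nat set \<Rightarrow> nat set set" where
  "edges_in C K = {e \<in> C. e \<subseteq> K}"

lemma finite_edges_in: "finite K \<Longrightarrow> finite (edges_in C K)"
  by (rule finite_subset[of _ "Pow K"]) (auto simp: edges_in_def)

lemma card_4_distinct: "distinct [a, b, c, d] \<Longrightarrow> card {{a, b}, {b, c}, {c, d}, {d, a :: nat}} = 4"
  by (subst card_insert_disjoint; force simp: doubleton_eq_iff)+

text \<open>On four vertices the 4-cycle uses up all permitted edges, so there is no triangle. On
  five vertices six edges are permitted, and the cycle with an attached edge leaves one more edge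
  \<open>g\<close>, through which every triangle must pass.\<close>

lemma small_triangle_bound:
  assumes K: "component C K" "finite K" and irr: "\<And>x. \<not> adj C x x" and C4: "C4_in C K"
    and small: "card K \<le> 5" and few: "card (edges_in C K) \<le> 2 * card K - 4"
  shows "2 * card (triangles C K) \<le> card K"
proof -
  have finE: "finite (edges_in C K)" using K(2) by (rule finite_edges_in)
  have adjE: "{x, y} \<in> edges_in C K" if "adj C x y" "x \<in> K" "y \<in> K" for x y
    using that by (auto simp: edges_in_def adj_def)
  have tri: "\<exists>x y z. T = {x, y, z} \<and> x \<noteq> y \<and> x \<noteq> z \<and> y \<noteq> z \<and> adj C x y \<and> adj C x z \<and> adj C y z \<and> x \<in> K \<and> y \<in> K \<and> z \<in> K"
    if T: "T \<in> triangles C K" for T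
  proof -
    have "T \<noteq> {}" using T by (auto simp: triangles_def)
    then obtain x where x: "x \<in> T" by blast
    obtain y z where "T = {x, y, z}" "y \<noteq> x" "z \<noteq> x" "z \<noteq> y" "adj C x y" "adj C x z" "adj C y z"
      using triangle_others[OF T x] by metis
    moreover have "T \<subseteq> K" using that by (auto simp: triangles_def)
    ultimately show ?thesis by blast
  qed
  show ?thesis
  proof (cases "card K \<le> 4")
    case True
    obtain a b c d where in_K: "a \<in> K" "b \<in> K" "c \<in> K" "d \<in> K" and D: "distinct [a, b, c, d]"
      and E: "adj C a b" "adj C b c" "adj C c d" "adj C d a"
      using C4 unfolding C4_in_def by blast
    have "card {a, b, c, d} = 4" using D by auto
    then have Keq: "K = {a, b, c, d}" using True in_K K(2) by (intro card_seteq[symmetric]) auto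
    have "{{a, b}, {b, c}, {c, d}, {d, a}} \<subseteq> edges_in C K"
      using adjE[OF E(1)] adjE[OF E(2)] adjE[OF E(3)] adjE[OF E(4)] in_K by simp
    moreover have "card (edges_in C K) \<le> card {{a, b}, {b, c}, {c, d}, {d, a}}"
      unfolding card_4_distinct[OF D] using few True by linarith
    ultimately have edges: "edges_in C K = {{a, b}, {b, c}, {c, d}, {d, a}}"
      using card_seteq[OF finE] by metis
    have adj_iff: "{x, y} \<in> {{a, b}, {b, c}, {c, d}, {d, a}}" if "adj C x y" "x \<in> K" "y \<in> K" for x y
      using adjE[OF that] unfolding edges .
    have "triangles C K = {}"
    proof (rule ccontr)
      assume "triangles C K \<noteq> {}"
      then obtain x y z where "x \<in> K" "y \<in> K" "z \<in> K" "x \<noteq> y" "x \<noteq> z" "y \<noteq> z" "adj C x y" "adj C x z" "adj C y z"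
        using tri by blast
      then show False using D adj_iff[of x y] adj_iff[of x z] adj_iff[of y z]
        unfolding Keq by (auto simp: doubleton_eq_iff)
    qed
    then show ?thesis by simp
  next
    case False
    then have k5: "card K = 5" and gt4: "card K > 4" using small by simp_all
    obtain u x1 v x2 t where D: "distinct [u, x1, v, x2]"
      and in_K: "u \<in> K" "x1 \<in> K" "v \<in> K" "x2 \<in> K" "t \<in> K"
      and E: "adj C u x1" "adj C x1 v" "adj C v x2" "adj C x2 u" and t: "t \<notin> {u, x1, v, x2}" "adj C t u"
      using C4_attached[OF K(1) gt4 C4 order_refl order_refl] by metis
    have "card {u, x1, v, x2, t} = 5" using D t by auto
    then have Keq: "K = {u, x1, v, x2, t}" using k5 in_K K(2) by (intro card_seteq[symmetric]) auto
    \<comment> \<open>Bipartite with \<open>u\<close> and \<open>v\<close> on one side, hence free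
      of triangles.\<close>
    define F where "F = {{u, x1}, {x1, v}, {v, x2}, {x2, u}, {t, u}}"
    have cF: "card F = 5"
      unfolding F_def using D t by (subst card_insert_disjoint; force simp: doubleton_eq_iff)+
    have FE: "F \<subseteq> edges_in C K" 
      unfolding F_def
      using adjE[OF E(1)] adjE[OF E(2)] adjE[OF E(3)] adjE[OF E(4)] adjE[OF t(2)] in_K by simp
    have "card (edges_in C K - F) \<le> 1"
      using few k5 cF FE finE by (simp add: card_Diff_subset finite_subset)
    then have uniq: "\<And>a b. a \<in> edges_in C K - F \<Longrightarrow> b \<in> edges_in C K - F \<Longrightarrow> a = b"
      using card_le_Suc0_iff_eq[of "edges_in C K - F"] finE by auto
    obtain g where g: "edges_in C K \<subseteq> insert g F"
      using uniq by blast
    have adjD: "{x, y} = g \<or> {x, y} \<in> F" if "adj C x y" "x \<in> K" "y \<in> K" for x y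
      using g adjE[OF that] by blast
    have ng: "\<exists>p q. g = {p, q} \<and> p \<in> T \<and> q \<in> T \<and> p \<noteq> q" if T: "T \<in> triangles C K" for T
    proof -
      obtain x y z where xyz: "T = {x, y, z}" "x \<in> K" "y \<in> K" "z \<in> K" "x \<noteq> y" "x \<noteq> z" "y \<noteq> z" "adj C x y" "adj C x z" "adj C y z"
        using tri[OF T] by blast
      have "\<not> ({x, y} \<in> F \<and> {x, z} \<in> F \<and> {y, z} \<in> F)"
        using xyz(2-7) D t unfolding Keq F_def by (auto simp: doubleton_eq_iff)
      then show ?thesis using adjD xyz by blast
    qed
    show ?thesis
    proof (cases "triangles C K = {}")
      case False
      then obtain T where T: "T \<in> triangles C K" by blast
      then have "T \<subseteq> K" by (simp add: triangles_def)
      then obtain p q where pq: "g = {p, q}" "p \<noteq> q" "p \<in> K" "q \<in> K"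
        using ng[OF T] by blast
      \<comment> \<open>Since \<open>t\<close> has only one neighbour in \<open>F\<close>, some
        vertex \<open>z\<close> completes no triangle over \<open>pq\<close>. At most two of the
        other three vertices remain.\<close>
      have "\<exists>z\<in>K - {p, q}. {p, z} \<notin> F \<or> {q, z} \<notin> F"
      proof (cases "t \<in> {p, q}")
        case True
        have "\<exists>z\<in>{x1, v, x2}. z \<notin> {p, q}" using True D t by auto
        then obtain z where "z \<in> {x1, v, x2}" "z \<notin> {p, q}" by blast
        moreover from this have "{t, z} \<notin> F" using D t by (auto simp: F_def doubleton_eq_iff)
        ultimately show ?thesis using True unfolding Keq by blast
      next
        case False
        then have "{p, t} \<notin> F \<or> {q, t} \<notin> F" using pq(2) t by (auto simp: F_def doubleton_eq_iff)
        then show ?thesis using False in_K(5) by blast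
      qed
      then obtain z where z: "z \<in> K - {p, q}" "{p, z} \<notin> F \<or> {q, z} \<notin> F" by blast
      have "triangles C K \<subseteq> (\<lambda>y. {p, q, y}) ` (K - {p, q, z})"
      proof
        fix T assume T: "T \<in> triangles C K"
        have "p \<in> T" "q \<in> T" using ng[OF T] pq by (auto simp: doubleton_eq_iff)
        then obtain y where y: "T = {p, q, y}" "y \<noteq> p" "y \<noteq> q" "adj C p y" "adj C q y"
          using triangle_third[OF T _ _ pq(2)] by metis
        have "y \<in> K" using T y by (auto simp: triangles_def)
        then have "{p, y} \<in> F" "{q, y} \<in> F"
          using adjD[of p y] adjD[of q y] y pq by (auto simp: doubleton_eq_iff)
        then show "T \<in> (\<lambda>y. {p, q, y}) ` (K - {p, q, z})" using y z \<open>y \<in> K\<close> by blast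
      qed
      then have "card (triangles C K) \<le> card (K - {p, q, z})"
        using K(2) by (meson card_image_le card_mono finite_Diff finite_imageI order_trans)
      also have "\<dots> = 2"
        using pq z K(2) k5 by (subst card_Diff_subset) auto
      finally show ?thesis using k5 by simp
    qed simp
  qed
qed

section \<open>Blocker's invariant\<close>

text \<open>One more edge of Constructor would turn any of these vertices into a page.\<close>

definition half_pages :: "nat set set \<Rightarrow> nat set set \<Rightarrow> nat set \<Rightarrow> nat \<Rightarrow> nat \<Rightarrow> nat set" where
  "half_pages C B K u v = {x \<in> K - {u, v}. adj C u x \<and> \<not> adj C v x \<and> \<not> adj B v x \<or>
     adj C v x \<and> \<not> adj C u x \<and> \<not> adj B u x}"

text \<open>Either Blocker owns \<open>uv\<close>, or even if the players alternately complete and destroy the remaining half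
  pages, Constructor first, at most half of the vertices become pages. Blocker's edge between two pages
  excludes \<open>K\<^sub>4\<close>.\<close>

definition safe_spine :: "nat set set \<Rightarrow> nat set set \<Rightarrow> nat set \<Rightarrow> nat \<Rightarrow> nat \<Rightarrow> bool" where
  "safe_spine C B K u v \<longleftrightarrow> spine C K u v \<and>
     (adj B u v \<or> adj C u v \<and>
       2 * card (pages C K u v) + card (half_pages C B K u v) \<le> 2 * (card K div 2) \<and>
       (\<forall>x y. pages C K u v = {x, y} \<longrightarrow> adj B x y))"

text \<open>In a component without 4-cycle, this ensures that when \<open>u\<close> and \<open>v\<close> become the spine of a book,
  at least one vertex can no longer become a page.\<close>

definition covered :: "nat set set \<Rightarrow> nat set set \<Rightarrow> nat set \<Rightarrow> bool" where
  "covered C B K \<longleftrightarrow> (\<exists>p\<in>K. \<exists>q\<in>K. (\<forall>z\<in>K. (\<forall>w\<in>K. \<not> adj B z w) \<longrightarrow> z = p \<or> z = q) \<and>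
     (p \<noteq> q \<longrightarrow> (\<forall>w. \<not> (adj C p w \<and> adj C q w))))"

text \<open>With a 4-cycle and at most five vertices there is no structural requirement; there the
  edge count in \<open>balanced\<close> gives the triangle bound.\<close>

definition structured :: "nat set set \<Rightarrow> nat set set \<Rightarrow> nat set \<Rightarrow> bool" where
  "structured C B K \<longleftrightarrow> (if C4_in C K then card K \<ge> 6 \<longrightarrow> (\<exists>u v. safe_spine C B K u v) else covered C B K)"

text \<open>The slack \<open>card K div 2\<close> is superadditive and therefore survives merging.
  On four or five vertices it equals 2, just what \<open>small_triangle_bound\<close> can
  afford.\<close>

definition balanced :: "nat set set \<Rightarrow> nat set set \<Rightarrow> nat set \<Rightarrow> bool" where
  "balanced C B K \<longleftrightarrow>
     (card K \<le> 5 \<longrightarrow> card (edges_in C K) \<le> card (edges_in B K) + card K div 2)"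

definition good :: "nat set set \<Rightarrow> nat set set \<Rightarrow> nat set \<Rightarrow> bool" where
  "good C B K \<longleftrightarrow> balanced C B K \<and> structured C B K"

lemma half_pages_commute: "half_pages C B K u v = half_pages C B K v u"
  by (auto simp: half_pages_def)

lemma safe_spine_commute: "safe_spine C B K u v \<longleftrightarrow> safe_spine C B K v u"
  unfolding safe_spine_def half_pages_commute[of C B K u v] pages_commute[of C K u v]
    spine_commute[of C K u v] adj_commute[of _ u v] by (rule refl)

lemma adj_mono: "C \<subseteq> D \<Longrightarrow> adj C x y \<Longrightarrow> adj D x y"
  by (auto simp: adj_def)

lemma finite_pages: "finite K \<Longrightarrow> finite (pages C K u v)"
  by (simp add: pages_def)

lemma finite_half_pages: "finite K \<Longrightarrow> finite (half_pages C B K u v)"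
  by (simp add: half_pages_def)

text \<open>Extra edges never hurt Blocker. He can therefore move arbitrarily whenever the position
  requires no particular answer.\<close>

lemma structured_mono:
  assumes "structured C B K" "B \<subseteq> B'" "finite K"
  shows "structured C B' K"
proof (cases "C4_in C K")
  case True
  have "safe_spine C B' K u v" if s: "safe_spine C B K u v" for u v
  proof -
    have "half_pages C B' K u v \<subseteq> half_pages C B K u v"
      using adj_mono[OF assms(2)] by (auto simp: half_pages_def)
    then have "card (half_pages C B' K u v) \<le> card (half_pages C B K u v)"
      using assms(3) by (intro card_mono finite_half_pages)
    then show ?thesis using s adj_mono[OF assms(2)] unfolding safe_spine_def
      by (meson add_left_mono order_trans)
  qed
  then show ?thesis using assms(1) True by (auto simp: structured_def)
next
  case False
  then obtain p q where pq: "p \<in> K" "q \<in> K" and z: "\<forall>z\<in>K. (\<forall>w\<in>K. \<not> adj B z w) \<longrightarrow> z = p \<or> z = q"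
    and com: "p \<noteq> q \<longrightarrow> (\<forall>w. \<not> (adj C p w \<and> adj C q w))"
    using assms(1) unfolding structured_def covered_def if_not_P[OF False] by blast
  have "\<forall>z\<in>K. (\<forall>w\<in>K. \<not> adj B' z w) \<longrightarrow> z = p \<or> z = q"
    using z adj_mono[OF assms(2)] by blast
  with pq com have "covered C B' K" unfolding covered_def by blast
  then show ?thesis using False by (simp add: structured_def)
qed

lemma balanced_mono:
  assumes "balanced C B K" "B \<subseteq> B'" "finite K"
  shows "balanced C B' K"
proof -
  have "card (edges_in B K) \<le> card (edges_in B' K)"
    using assms by (intro card_mono finite_edges_in) (auto simp: edges_in_def)
  then show ?thesis using assms(1) unfolding balanced_def by linarith
qed

lemma good_mono: "good C B K \<Longrightarrow> B \<subseteq> B' \<Longrightarrow> finite K \<Longrightarrow> good C B' K"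
  using balanced_mono structured_mono unfolding good_def by blast

section \<open>From the invariant to the triangle bound\<close>

lemma edges_in_subset_pairs: "C \<subseteq> edges_K n \<Longrightarrow> edges_in C K \<subseteq> {e. e \<subseteq> K \<and> card e = 2}"
  unfolding edges_in_def edges_K_def card_2_iff by blast

lemma card_edges_in_sum:
  assumes "C \<subseteq> edges_K n" "B \<subseteq> edges_K n" "C \<inter> B = {}" "finite K"
  shows "card (edges_in C K) + card (edges_in B K) \<le> card K choose 2"
proof -
  have "card (edges_in C K) + card (edges_in B K) = card (edges_in C K \<union> edges_in B K)"
    using assms by (intro card_Un_disjoint[symmetric] finite_edges_in) (auto simp: edges_in_def)
  also have "\<dots> \<le> card {e. e \<subseteq> K \<and> card e = 2}"
    using assms by (intro card_mono Un_least edges_in_subset_pairs) auto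
  also have "\<dots> = card K choose 2" by (rule n_subsets[OF assms(4)])
  finally show ?thesis .
qed

lemma card_ge_6D:
  assumes "card K \<ge> 6" obtains t where "t \<in> K" "t \<notin> {a, b, c, d}"
proof -
  have "card {a, b, c, d} \<le> 4" using card_length[of "[a, b, c, d]"] by simp
  then have "\<not> K \<subseteq> {a, b, c, d}" using assms card_mono[of "{a, b, c, d}" K] by auto
  then show ?thesis using that by blast
qed

text \<open>If Constructor owns \<open>uv\<close>, an edge off the spine would join the only two
  pages, which Blocker's edge forbids; so triangles correspond to pages, at most half of the
  vertices. If she does not, every triangle consists of two adjacent pages and one of
  \<open>u\<close>, \<open>v\<close>. There are then at most two triangles, which six vertices pay
  for.\<close>

lemma spine_triangle_bound:
  assumes s: "safe_spine C B K u v" and K: "finite K" "card K \<ge> 6" and irr: "\<And>x. \<not> adj C x x"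
    and dis: "C \<inter> B = {}"
  shows "2 * card (triangles C K) \<le> card K"
proof -
  have sp: "spine C K u v" using s by (simp add: safe_spine_def)
  have disj: "adj C a b \<Longrightarrow> \<not> adj B a b" for a b using dis by (auto simp: adj_def)
  have T: "\<exists>x y z. T = {x, y, z} \<and> x \<noteq> y \<and> x \<noteq> z \<and> y \<noteq> z \<and> adj C x y \<and> adj C x z \<and> adj C y z \<and> x \<in> K \<and> y \<in> K \<and> z \<in> K"
    if T: "T \<in> triangles C K" for T
  proof -
    have "T \<noteq> {}" using T by (auto simp: triangles_def)
    then obtain x where x: "x \<in> T" by blast
    obtain y z where "T = {x, y, z}" "y \<noteq> x" "z \<noteq> x" "z \<noteq> y" "adj C x y" "adj C x z" "adj C y z"
      using triangle_others[OF T x] by metis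
    moreover have "T \<subseteq> K" using T by (auto simp: triangles_def)
    ultimately show ?thesis by blast
  qed
  have uv: "u \<in> K" "v \<in> K" "u \<noteq> v" using sp by (auto simp: spine_def)
  have off: "pages C K u v = {y, z}" if "y \<in> K" "z \<in> K" "y \<notin> {u, v}" "z \<notin> {u, v}" "adj C y z" for y z
    using sp that unfolding spine_def by blast
  show ?thesis
  proof (cases "adj C u v")
    case True
    then have J: "2 * card (pages C K u v) \<le> 2 * (card K div 2)"
      and pg: "\<And>x y. pages C K u v = {x, y} \<Longrightarrow> adj B x y"
      using s disj[OF True] unfolding safe_spine_def by auto
    have "triangles C K \<subseteq> (\<lambda>p. {u, v, p}) ` pages C K u v"
    proof
      fix T assume t: "T \<in> triangles C K"
      have no: "y \<in> {u, v} \<or> z \<in> {u, v}" if "y \<in> T" "z \<in> T" "y \<noteq> z" for y z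
      proof (rule ccontr)
        assume n: "\<not> (y \<in> {u, v} \<or> z \<in> {u, v})"
        have "adj C y z" "y \<in> K" "z \<in> K" using t that by (auto simp: triangles_def)
        then show False using off[of y z] pg[of y z] disj n by blast
      qed
      obtain x y z where xyz: "T = {x, y, z}" "x \<noteq> y" "x \<noteq> z" "y \<noteq> z" using T[OF t] by blast
      have uT: "u \<in> T" "v \<in> T" using no[of x y] no[of x z] no[of y z] xyz by auto
      obtain p where p: "T = {u, v, p}" "adj C u p" "adj C v p"
        using triangle_third[OF t uT uv(3)] by metis
      moreover have "p \<in> K" using t p by (auto simp: triangles_def)
      ultimately show "T \<in> (\<lambda>p. {u, v, p}) ` pages C K u v" by (auto simp: pages_def)
    qed
    then have "card (triangles C K) \<le> card (pages C K u v)"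
      using finite_pages[OF K(1)] by (meson card_image_le card_mono finite_imageI order_trans)
    then show ?thesis using J by linarith
  next
    case False
    have "triangles C K \<subseteq> {insert u (pages C K u v), insert v (pages C K u v)}"
    proof
      fix T assume t: "T \<in> triangles C K"
      obtain x y z where xyz: "T = {x, y, z}" "x \<noteq> y" "x \<noteq> z" "y \<noteq> z" "adj C x y" "adj C x z" "adj C y z"
        "x \<in> K" "y \<in> K" "z \<in> K" using T[OF t] by blast
      have nuv: "\<not> (u \<in> T \<and> v \<in> T)" using False t uv(3) by (auto simp: triangles_def)
      have "\<not> (x \<notin> {u, v} \<and> y \<notin> {u, v} \<and> z \<notin> {u, v})"
      proof
        assume n: "x \<notin> {u, v} \<and> y \<notin> {u, v} \<and> z \<notin> {u, v}"
        have "pages C K u v = {x, y}" using off[of x y] xyz n by blast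
        moreover have "pages C K u v = {x, z}" using off[of x z] xyz n by blast
        ultimately show False using xyz by (auto simp: doubleton_eq_iff)
      qed
      then consider "x \<in> {u, v}" | "y \<in> {u, v}" | "z \<in> {u, v}" by blast
      then show "T \<in> {insert u (pages C K u v), insert v (pages C K u v)}"
      proof cases
        case 1
        then have "y \<notin> {u, v}" "z \<notin> {u, v}" using nuv xyz by auto
        then show ?thesis using off[of y z] xyz 1 by auto
      next
        case 2
        then have "x \<notin> {u, v}" "z \<notin> {u, v}" using nuv xyz by auto
        then show ?thesis using off[of x z] xyz 2 by auto
      next
        case 3
        then have "x \<notin> {u, v}" "y \<notin> {u, v}" using nuv xyz by auto
        then show ?thesis using off[of x y] xyz 3 by auto
      qed
    qed
    then have "card (triangles C K) \<le> card {insert u (pages C K u v), insert v (pages C K u v)}"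
      by (intro card_mono) auto
    also have "\<dots> \<le> 2" by (simp add: card_insert_if)
    finally show ?thesis using K(2) by linarith
  qed
qed

text \<open>Add the balance condition to the bound of 6 or 10 on the total number of pairs: twice
  Constructor's edges are at most 8 or 12.\<close>

lemma balanced_few_edges:
  assumes CB: "C \<subseteq> edges_K n" "B \<subseteq> edges_K n" "C \<inter> B = {}" and K: "finite K" "card K = 4 \<or> card K = 5"
    and bal: "balanced C B K"
  shows "card (edges_in C K) \<le> 2 * card K - 4"
proof -
  have "card (edges_in C K) + card (edges_in B K) \<le> card K choose 2"
    by (rule card_edges_in_sum[OF CB K(1)])
  moreover have "card (edges_in C K) \<le> card (edges_in B K) + 2"
    using bal K(2) by (auto simp: balanced_def)
  ultimately show ?thesis using K(2) by (auto simp: choose_two)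
qed

lemma good_triangle_bound:
  assumes CB: "C \<subseteq> edges_K n" "B \<subseteq> edges_K n" "C \<inter> B = {}" and K: "component C K"
    and free: "P6_free C" and good: "good C B K"
  shows "2 * card (triangles C K) \<le> card K"
proof -
  have fin: "finite K" using component_finite[OF CB(1) K] by blast
  have irr: "\<And>x. \<not> adj C x x" by (rule adj_irrefl[OF CB(1)])
  show ?thesis
  proof (cases "C4_in C K")
    case False
    then show ?thesis using C4_free_triangle_bound[OF K fin free irr] by blast
  next
    case True
    show ?thesis
    proof (cases "card K \<ge> 6")
      case False
      obtain a b c d where "{a, b, c, d} \<subseteq> K" "distinct [a, b, c, d]"
        using True unfolding C4_in_def by blast
      then have "4 \<le> card K" using card_mono[OF fin, of "{a, b, c, d}"] by simp
      then have k: "card K = 4 \<or> card K = 5" using False by auto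
      then have "card (edges_in C K) \<le> 2 * card K - 4"
        using balanced_few_edges[OF CB fin k] good by (auto simp: good_def)
      then show ?thesis using small_triangle_bound[OF K fin irr True] k by auto
    next
      case large: True
      then obtain u v where "safe_spine C B K u v" using good True by (auto simp: good_def structured_def)
      then show ?thesis using spine_triangle_bound[OF _ fin large irr CB(3)] by blast
    qed
  qed
qed

section \<open>Blocker's answer\<close>

text \<open>The position once Constructor has chosen the edge \<open>xy\<close> and Blocker has not
  yet answered. \<open>C\<close> is her graph before the move, and \<open>K\<close> and
  \<open>L\<close> may coincide.\<close>

locale blocker_turn =
  fixes n :: nat and C B :: "nat set set" and x y :: nat and K L :: "nat set"
  assumes CE: "C \<subseteq> edges_K n" and BE: "B \<subseteq> edges_K n" and CB: "C \<inter> B = {}"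
    and xy: "{x, y} \<in> edges_K n - (C \<union> B)"
    and free: "P6_free (insert {x, y} C)"
    and K: "component C K" "x \<in> K" and L: "component C L" "y \<in> L"
    and goodK: "good C B K" and goodL: "good C B L"
begin

abbreviation C' where "C' \<equiv> insert {x, y} C"
abbreviation K' where "K' \<equiv> K \<union> L"

text \<open>Concerns only the structural half of the invariant. The balance is arranged in
  \<open>good_response\<close>, where an arbitrary edge serves if the structure demands no
  answer.\<close>

definition answerable :: bool where
  "answerable \<longleftrightarrow> structured C' B K' \<or>
     (\<exists>a\<in>K'. \<exists>b\<in>K'. a \<noteq> b \<and> \<not> adj C' a b \<and> \<not> adj B a b \<and> structured C' (insert {a, b} B) K')"

lemma swap: "blocker_turn n C B y x L K"
  by (unfold_locales) (use CE BE CB xy free K L goodK goodL in \<open>simp_all add: insert_commute\<close>)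

lemma answerable_swap: "blocker_turn.answerable C B y x L K \<Longrightarrow> answerable"
  unfolding blocker_turn.answerable_def[OF swap] answerable_def
  by (simp add: insert_commute Un_commute)

text \<open>If Blocker already owns \<open>ab\<close>, the claim changes nothing and no answer is
  required. Thus it is enough to check that Constructor does not own it.\<close>

lemma answerI:
  assumes "a \<in> K'" "b \<in> K'" "a \<noteq> b" "\<not> adj C' a b" "structured C' (insert {a, b} B) K'"
  shows answerable
proof (cases "adj B a b")
  case True
  then have "insert {a, b} B = B" by (auto simp: adj_def)
  then show ?thesis using assms(5) by (simp add: answerable_def)
next
  case False
  then show ?thesis using assms unfolding answerable_def by blast
qed

lemma C'E: "C' \<subseteq> edges_K n" using CE xy by auto

lemma irr: "\<not> adj C' z z" by (rule adj_irrefl[OF C'E])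
lemma irrC: "\<not> adj C z z" by (rule adj_irrefl[OF CE])
lemma irrB: "\<not> adj B z z" by (rule adj_irrefl[OF BE])

lemma xny: "x \<noteq> y" using irr[of x] by (auto simp: adj_def)

lemma not_adj_xy: "\<not> adj C x y" "\<not> adj B x y" using xy by (auto simp: adj_def)

lemma adjC': "adj C' a b \<longleftrightarrow> adj C a b \<or> a = x \<and> b = y \<or> a = y \<and> b = x"
  by (auto simp: adj_insert)

lemma disj: "adj C' a b \<Longrightarrow> \<not> adj B a b"
  using CB xy by (auto simp: adj_def)

lemma K': "component C' K'" by (rule component_insert[OF K(1) L(1) K(2) L(2)])

lemma fin: "finite K" "finite L" "finite K'"
  using component_finite(1)[OF CE K(1)] component_finite(1)[OF CE L(1)] by auto

lemma K_L_cases: "K = L \<or> K \<inter> L = {}"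
  using component_unique[OF K(1) L(1)] by blast

lemma K'_less: "K' \<subseteq> {0..<n}"
proof -
  have "x < n" "y < n" using adj_less[OF C'E, of x y] by (simp_all add: adj_insert)
  then show ?thesis using component_finite(2)[OF CE K] component_finite(2)[OF CE L] by blast
qed

section \<open>Answers when the enlarged component has no 4-cycle\<close>

lemma C4_mono: "C4_in C K \<Longrightarrow> C4_in C' K'"
  unfolding C4_in_def adjC' by blast

text \<open>A merge may leave four exceptional vertices without a Blocker edge. Claiming
  \<open>ab\<close> across the two sides covers one on each side, and \<open>p\<close>,
  \<open>q\<close> are the exceptions that remain.\<close>

lemma covered_by_claim:
  assumes KL: "K \<noteq> L" and C4: "\<not> C4_in C' K'" and ab: "a \<in> K" "b \<in> L" "\<not> (a = x \<and> b = y)"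
    and pq: "p \<in> K'" "q \<in> K'" "p \<noteq> q \<longrightarrow> (\<forall>w. \<not> (adj C' p w \<and> adj C' q w))"
    and uK: "\<And>z. z \<in> K \<Longrightarrow> \<forall>w\<in>K. \<not> adj B z w \<Longrightarrow> z = a \<or> z = p \<or> z = q"
    and uL: "\<And>z. z \<in> L \<Longrightarrow> \<forall>w\<in>L. \<not> adj B z w \<Longrightarrow> z = b \<or> z = p \<or> z = q"
  shows answerable
proof (rule answerI[of a b])
  have dis: "K \<inter> L = {}" using KL K_L_cases by blast
  show "a \<in> K'" "b \<in> K'" "a \<noteq> b" using ab dis by blast+
  show "\<not> adj C' a b" using ab dis component_closed[OF K(1), of a b] L(2) unfolding adjC' by blast
  have "z = p \<or> z = q" if z: "z \<in> K'" "\<forall>w\<in>K'. \<not> adj (insert {a, b} B) z w" for z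
  proof -
    have nB: "\<forall>w\<in>K'. \<not> adj B z w" using z by (auto simp: adj_insert)
    have "z \<noteq> a" "z \<noteq> b" using z ab by (auto simp: adj_insert)
    then show ?thesis using uK[of z] uL[of z] z(1) nB by blast
  qed
  then have "covered C' (insert {a, b} B) K'"
    unfolding covered_def using pq by blast
  then show "structured C' (insert {a, b} B) K'" using C4 by (simp add: structured_def)
qed

text \<open>The edge \<open>xy\<close> is the only connection between \<open>K\<close> and
  \<open>L\<close>, so a path \<open>p w q\<close> from one to the other must use it.\<close>

lemma common_nbr_cross:
  assumes KL: "K \<noteq> L" and "p \<in> K" "q \<in> L" "adj C' p w" "adj C' q w"
  shows "p = x \<and> adj C q y \<or> q = y \<and> adj C p x"
proof -
  have dis: "K \<inter> L = {}" using KL K_L_cases by blast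
  have "adj C p w \<or> p = x \<and> w = y" using assms(2,4) dis L(2) unfolding adjC' by blast
  moreover have "adj C q w \<or> q = y \<and> w = x" using assms(3,5) dis K(2) unfolding adjC' by blast
  moreover have "\<not> (adj C p w \<and> adj C q w)"
    using dis component_closed[OF K(1) assms(2)] component_closed[OF L(1) assms(3)] by blast
  ultimately show ?thesis using xny by blast
qed

text \<open>Blocker joins an exceptional vertex of \<open>K\<close> to one of \<open>L\<close>. He
  chooses them so that the two remaining exceptions have no common neighbour, and so that the edge
  differs from \<open>xy\<close>. The cases record which of \<open>x\<close>, \<open>y\<close> are
  exceptional and whether a side has only one exception.\<close>

lemma C4_free_merge:
  assumes KL: "K \<noteq> L" and C4: "\<not> C4_in C' K'"
  shows answerable
proof -
  have dis: "K \<inter> L = {}" using KL K_L_cases by blast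
  have "\<not> C4_in C K" using C4 C4_mono by blast
  then have "covered C B K" using goodK by (simp add: good_def structured_def)
  then obtain p1 q1 where 1: "p1 \<in> K" "q1 \<in> K" "\<And>z. z \<in> K \<Longrightarrow> \<forall>w\<in>K. \<not> adj B z w \<Longrightarrow> z = p1 \<or> z = q1"
    unfolding covered_def by blast
  have "\<not> C4_in C L" using C4 unfolding C4_in_def adjC' by blast
  then have "covered C B L" using goodL by (simp add: good_def structured_def)
  then obtain p2 q2 where 2: "p2 \<in> L" "q2 \<in> L" "\<And>z. z \<in> L \<Longrightarrow> \<forall>w\<in>L. \<not> adj B z w \<Longrightarrow> z = p2 \<or> z = q2"
    unfolding covered_def by blast
  \<comment> \<open>The remaining pair is harmless if it is \<open>x\<close>, \<open>y\<close>
    itself or avoids both.\<close>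
  have cross: "\<not> (adj C' p w \<and> adj C' q w)" if "p \<in> K" "q \<in> L" "p = x \<longleftrightarrow> q = y" for p q w
    using common_nbr_cross[OF KL that(1,2), of w] that(3) irrC by blast
  have claim: answerable if "a1 \<in> K" "b1 \<in> K" "{p1, q1} = {a1, b1}" "a2 \<in> L" "b2 \<in> L" "{p2, q2} = {a2, b2}"
    "\<not> (a1 = x \<and> a2 = y)" "b1 = x \<longleftrightarrow> b2 = y" for a1 b1 a2 b2
  proof (rule covered_by_claim[OF KL C4, of a1 a2 b1 b2])
    show "z = a1 \<or> z = b1 \<or> z = b2" if "z \<in> K" "\<forall>w\<in>K. \<not> adj B z w" for z
      using 1(3)[OF that] \<open>{p1, q1} = {a1, b1}\<close> by blast
    show "z = a2 \<or> z = b1 \<or> z = b2" if "z \<in> L" "\<forall>w\<in>L. \<not> adj B z w" for z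
      using 2(3)[OF that] \<open>{p2, q2} = {a2, b2}\<close> by blast
    show "b1 \<noteq> b2 \<longrightarrow> (\<forall>w. \<not> (adj C' b1 w \<and> adj C' b2 w))" using cross that by blast
  qed (use that in blast)+
  have single1: answerable if "p1 = x" "q1 = x" "y \<notin> {p2, q2}"
  proof (rule covered_by_claim[OF KL C4, of x p2 q2 q2])
    show "z = x \<or> z = q2 \<or> z = q2" if "z \<in> K" "\<forall>w\<in>K. \<not> adj B z w" for z
      using 1(3)[OF that] \<open>p1 = x\<close> \<open>q1 = x\<close> by blast
    show "z = p2 \<or> z = q2 \<or> z = q2" if "z \<in> L" "\<forall>w\<in>L. \<not> adj B z w" for z
      using 2(3)[OF that] by blast
  qed (use that 1 2 K L in blast)+
  have single2: answerable if "p2 = y" "q2 = y" "x \<notin> {p1, q1}"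
  proof (rule covered_by_claim[OF KL C4, of p1 y q1 q1])
    show "z = p1 \<or> z = q1 \<or> z = q1" if "z \<in> K" "\<forall>w\<in>K. \<not> adj B z w" for z
      using 1(3)[OF that] by blast
    show "z = y \<or> z = q1 \<or> z = q1" if "z \<in> L" "\<forall>w\<in>L. \<not> adj B z w" for z
      using 2(3)[OF that] \<open>p2 = y\<close> \<open>q2 = y\<close> by blast
  qed (use that 1 2 K L in blast)+
  have both: answerable if "p1 = x" "q1 = x" "p2 = y" "q2 = y"
  proof -
    have "z = x \<or> z = y" if z: "z \<in> K'" "\<forall>w\<in>K'. \<not> adj B z w" for z
      using 1(3)[of z] 2(3)[of z] z that \<open>p1 = x\<close> \<open>q1 = x\<close> \<open>p2 = y\<close> \<open>q2 = y\<close> by blast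
    moreover have "\<forall>w. \<not> (adj C' x w \<and> adj C' y w)" using cross K(2) L(2) by blast
    ultimately have "covered C' B K'" unfolding covered_def using K(2) L(2) by blast
    then show ?thesis using C4 by (simp add: answerable_def structured_def)
  qed
  consider "x \<in> {p1, q1}" "y \<in> {p2, q2}" | "x \<in> {p1, q1}" "y \<notin> {p2, q2}"
    | "x \<notin> {p1, q1}" "y \<in> {p2, q2}" | "x \<notin> {p1, q1}" "y \<notin> {p2, q2}" by blast
  then show ?thesis
  proof cases
    case 1
    obtain a1 where a1: "{p1, q1} = {a1, x}" using 1(1) by blast
    obtain a2 where a2: "{p2, q2} = {a2, y}" using 1(2) by blast
    have "{a1, x} \<subseteq> K" "{a2, y} \<subseteq> L"
      unfolding a1[symmetric] a2[symmetric]
      using \<open>p1 \<in> K\<close> \<open>q1 \<in> K\<close> \<open>p2 \<in> L\<close> \<open>q2 \<in> L\<close> by simp_all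
    then have in_: "a1 \<in> K" "a2 \<in> L" by simp_all
    show ?thesis
    proof (cases "a1 = x \<and> a2 = y")
      case True
      then show ?thesis using both a1 a2 by (simp add: doubleton_eq_iff)
    next
      case False
      then show ?thesis using claim[of a1 x a2 y] a1 a2 in_ K L by blast
    qed
  next
    case 2
    obtain b1 where b1: "{p1, q1} = {x, b1}" using 2(1) by blast
    have "{x, b1} \<subseteq> K" unfolding b1[symmetric] using \<open>p1 \<in> K\<close> \<open>q1 \<in> K\<close> by simp
    then have "b1 \<in> K" by simp
    show ?thesis
    proof (cases "b1 = x")
      case True
      then show ?thesis using single1 b1 2 by (simp add: doubleton_eq_iff)
    next
      case False
      then show ?thesis using claim[of x b1 p2 q2] b1 \<open>b1 \<in> K\<close> 2 \<open>p2 \<in> L\<close> \<open>q2 \<in> L\<close> K(2) by blast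
    qed
  next
    case 3
    obtain b2 where b2: "{p2, q2} = {y, b2}" using 3(2) by blast
    have "{y, b2} \<subseteq> L" unfolding b2[symmetric] using \<open>p2 \<in> L\<close> \<open>q2 \<in> L\<close> by simp
    then have "b2 \<in> L" by simp
    show ?thesis
    proof (cases "b2 = y")
      case True
      then show ?thesis using single2 b2 3 by (simp add: doubleton_eq_iff)
    next
      case False
      then show ?thesis using claim[of p1 q1 y b2] b2 \<open>b2 \<in> L\<close> 3 \<open>p1 \<in> K\<close> \<open>q1 \<in> K\<close> L(2) by blast
    qed
  next
    case 4
    then show ?thesis
      using claim[of p1 q1 p2 q2] \<open>p1 \<in> K\<close> \<open>q1 \<in> K\<close> \<open>p2 \<in> L\<close> \<open>q2 \<in> L\<close> by blast
  qed
qed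

text \<open>An answer is needed only if the exceptions \<open>p\<close> and \<open>q\<close> acquire
  a common neighbour \<open>w\<close>. Blocker then covers one of them by any pair that Constructor
  does not own. If no such pair exists, \<open>p\<close> and \<open>q\<close> are joined to all of
  \<open>K\<close>: a fourth vertex \<open>z\<close> gives the 4-cycle \<open>p w q z\<close>, and
  without one \<open>w\<close> would be a third exception.\<close>

lemma C4_free_inside:
  assumes KL: "K = L" and C4: "\<not> C4_in C' K'"
  shows answerable
proof -
  have "\<not> C4_in C K" using C4 C4_mono by blast
  then have "covered C B K" using goodK by (simp add: good_def structured_def)
  then obtain p q where pq: "p \<in> K" "q \<in> K" and unc: "\<And>z. z \<in> K \<Longrightarrow> \<forall>w\<in>K. \<not> adj B z w \<Longrightarrow> z = p \<or> z = q"
    unfolding covered_def by blast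
  have claim: answerable if r: "{p, q} = {r, s}" "z \<in> K" "z \<noteq> r" "\<not> adj C' r z" for r s z
  proof (rule answerI[of r z])
    have "{r, s} \<subseteq> K" using pq unfolding r(1)[symmetric] by simp
    then have rs: "r \<in> K" "s \<in> K" by simp_all
    have pq_rs: "t = p \<or> t = q \<longleftrightarrow> t = r \<or> t = s" for t
      using r(1) by (auto simp: doubleton_eq_iff)
    show "r \<in> K'" "z \<in> K'" "r \<noteq> z" "\<not> adj C' r z" using rs r by auto
    have "t = s" if t: "t \<in> K'" "\<forall>w\<in>K'. \<not> adj (insert {r, z} B) t w" for t
    proof -
      have "\<forall>w\<in>K. \<not> adj B t w" "t \<noteq> r" using t r(2) by (auto simp: adj_insert)
      then show ?thesis using unc[of t] pq_rs[of t] t(1) KL by blast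
    qed
    then have "covered C' (insert {r, z} B) K'" unfolding covered_def using rs by blast
    then show "structured C' (insert {r, z} B) K'" using C4 by (simp add: structured_def)
  qed
  show ?thesis
  proof (cases "p \<noteq> q \<and> (\<exists>w. adj C' p w \<and> adj C' q w)")
    case False
    then have "covered C' B K'" unfolding covered_def using pq unc KL by blast
    then show ?thesis using C4 by (simp add: answerable_def structured_def)
  next
    case True
    then obtain w where pnq: "p \<noteq> q" and w: "adj C' p w" "adj C' q w" by blast
    have wK: "w \<in> K" using component_closed[OF K' _ w(1)] pq KL by blast
    have wpq: "w \<noteq> p" "w \<noteq> q" using w irr by blast+
    show ?thesis
    proof (cases "(\<forall>z\<in>K. z \<noteq> p \<longrightarrow> adj C' p z) \<and> (\<forall>z\<in>K. z \<noteq> q \<longrightarrow> adj C' q z)")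
      case False
      then show ?thesis using claim[of p q] claim[of q p] by blast
    next
      case all: True
      show ?thesis
      proof (cases "K = {p, q, w}")
        case True
        have "\<forall>t\<in>K. \<not> adj B w t"
          using True w disj irrB by (auto simp: adj_commute)
        then have False using unc[OF wK] wpq by blast
        then show ?thesis ..
      next
        case False
        then obtain z where z: "z \<in> K" "z \<noteq> p" "z \<noteq> q" "z \<noteq> w" using pq wK by blast
        have "C4_in C' K'"
          using all z w pq wK wpq pnq by (intro C4_inI[of p _ w q z]) (auto simp: adj_commute)
        then show ?thesis using C4 by blast
      qed
    qed
  qed
qed

end

text \<open>The two configurations that a limit of six edges on five vertices excludes: three pages
  over a spine edge, and a complete graph on four vertices with an attached edge.\<close>

lemma card_7_edges:
  assumes "distinct [u, v, a, b, c :: nat]"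
  shows "card {{u, v}, {u, a}, {v, a}, {u, b}, {v, b}, {u, c}, {v, c}} = 7"
    and "card {{u, v}, {u, a}, {v, a}, {u, b}, {v, b}, {a, b}, {u, c}} = 7"
  using assms by (subst card_insert_disjoint; force simp: doubleton_eq_iff)+

section \<open>Answers when a 4-cycle is present\<close>

context blocker_turn
begin

lemma safeI: "C4_in C' K' \<Longrightarrow> safe_spine C' B' K' u v \<Longrightarrow> structured C' B' K'"
  by (auto simp: structured_def)

text \<open>Each vertex of \<open>L\<close> must be adjacent to the spine, and \<open>xy\<close> is
  the only edge leaving \<open>K\<close> for \<open>L\<close>.\<close>

lemma spine_merge:
  assumes KL: "K \<noteq> L" and uv: "u \<in> K" "v \<in> K" and sp: "spine C' K' u v"
  shows "L = {y}" "x = u \<or> x = v"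
proof -
  have dis: "K \<inter> L = {}" using KL K_L_cases by blast
  have *: "z = y \<and> (x = u \<or> x = v)" if z: "z \<in> L" for z
  proof -
    have "z \<in> K' - {u, v}" using z dis uv by blast
    then have "adj C' u z \<or> adj C' v z" using sp unfolding spine_def by blast
    moreover have "\<not> adj C u z" "\<not> adj C v z" using z dis uv component_closed[OF K(1)] by blast+
    ultimately show ?thesis using uv z dis L(2) unfolding adjC' by blast
  qed
  then show "L = {y}" "x = u \<or> x = v" using L(2) by blast+
qed

lemma safe_by_claim_spine:
  assumes C4: "C4_in C' K'" and sp: "spine C' K' u v" and n: "\<not> adj C' u v"
  shows answerable
proof (rule answerI[of u v])
  show "u \<in> K'" "v \<in> K'" "u \<noteq> v" using sp by (auto simp: spine_def)
  show "structured C' (insert {u, v} B) K'"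
    by (rule safeI[OF C4, of _ u v]) (use sp in \<open>simp add: safe_spine_def adj_insert\<close>)
qed (rule n)

text \<open>The new vertex \<open>y\<close> hangs on \<open>u\<close>, and Blocker takes
  \<open>vy\<close>, so \<open>y\<close> will never be a page. Pages stay the same and half pages do
  not increase, while the component grows.\<close>

lemma spine_new_vertex:
  assumes KL: "K \<noteq> L" and C4: "C4_in C' K'" and s: "safe_spine C B K u v" and uv: "adj C u v"
    and sp: "spine C' K' u v" and xu: "x = u"
  shows answerable
proof (rule answerI[of v y])
  have dis: "K \<inter> L = {}" using KL K_L_cases by blast
  have in_K: "u \<in> K" "v \<in> K" "u \<noteq> v" using s by (auto simp: safe_spine_def spine_def)
  have Ly: "L = {y}" using spine_merge[OF KL in_K(1,2) sp] by blast
  have yK: "y \<notin> K" using dis L(2) by blast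
  show "v \<in> K'" "y \<in> K'" "v \<noteq> y" using in_K L(2) yK by auto
  have nvy: "\<not> adj C v y" using component_closed[OF K(1) in_K(2)] yK by blast
  have nuy: "\<not> adj C u y" using component_closed[OF K(1) in_K(1)] yK by blast
  show n: "\<not> adj C' v y" using nvy in_K xu yK unfolding adjC' by auto
  have adj_v: "adj C' v z \<longleftrightarrow> adj C v z" for z using in_K xu yK unfolding adjC' by auto
  have adj_u: "adj C' u z \<longleftrightarrow> adj C u z" if "z \<noteq> y" for z using in_K yK that unfolding adjC' by auto
  have "\<not> adj B u v" using disj uv unfolding adjC' by blast
  then have J: "2 * card (pages C K u v) + card (half_pages C B K u v) \<le> 2 * (card K div 2)"
    and pg: "\<And>a b. pages C K u v = {a, b} \<Longrightarrow> adj B a b"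
    using s unfolding safe_spine_def by auto
  have "pages C' K' u v = pages C K u v"
  proof (rule set_eqI)
    fix z show "z \<in> pages C' K' u v \<longleftrightarrow> z \<in> pages C K u v"
      using adj_v nvy yK adj_u[of z] by (cases "z = y") (simp_all add: pages_def Ly)
  qed
  moreover have "half_pages C' (insert {v, y} B) K' u v \<subseteq> half_pages C B K u v"
  proof
    fix z assume "z \<in> half_pages C' (insert {v, y} B) K' u v"
    then show "z \<in> half_pages C B K u v"
      using adj_v nvy adj_u[of z] in_K yK
      by (cases "z = y") (auto simp: half_pages_def Ly adj_insert)
  qed
  then have "card (half_pages C' (insert {v, y} B) K' u v) \<le> card (half_pages C B K u v)"
    by (intro card_mono finite_half_pages fin)
  moreover have "card K \<le> card K'" using fin by (intro card_mono) auto
  then have "2 * (card K div 2) \<le> 2 * (card K' div 2)" by (simp add: div_le_mono)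
  ultimately have "safe_spine C' (insert {v, y} B) K' u v"
    unfolding safe_spine_def using sp J pg uv by (auto simp: adj_insert)
  then show "structured C' (insert {v, y} B) K'" by (rule safeI[OF C4])
qed

text \<open>The spine dominates, so \<open>y\<close> was already joined to \<open>v\<close> and
  turns from a half page into a page. Twice the pages plus the half pages rises by 2 - 1, and
  Blocker compensates by spoiling another half page \<open>z\<close>. There are now at least three
  pages, so the clause about exactly two pages is void.\<close>

lemma spine_new_page:
  assumes KL: "K = L" and C4: "C4_in C' K'" and s: "safe_spine C B K u v" and uv: "adj C u v"
    and sp: "spine C' K' u v" and xu: "x = u"
  shows answerable
proof -
  have K'K: "K' = K" using KL by simp
  have in_K: "u \<in> K" "v \<in> K" "u \<noteq> v" using s by (auto simp: safe_spine_def spine_def)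
  have yK: "y \<in> K" using L(2) KL by simp
  have nuy: "\<not> adj C u y" using not_adj_xy xu by blast
  have yuv: "y \<noteq> u" "y \<noteq> v" using xny xu nuy uv by auto
  have vy: "adj C v y" using s nuy yK yuv unfolding safe_spine_def spine_def by blast
  have adj_v: "adj C' v z \<longleftrightarrow> adj C v z" for z using in_K xu yuv unfolding adjC' by auto
  have adj_u: "adj C' u z \<longleftrightarrow> adj C u z \<or> z = y" for z using in_K xu yuv unfolding adjC' by auto
  have "\<not> adj B u v" using disj uv unfolding adjC' by blast
  then have J: "2 * card (pages C K u v) + card (half_pages C B K u v) \<le> 2 * (card K div 2)"
    using s unfolding safe_spine_def by auto
  let ?H = "half_pages C B K u v"
  have yH: "y \<in> ?H" using yK yuv vy nuy not_adj_xy xu by (auto simp: half_pages_def)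
  have pages: "pages C' K' u v = insert y (pages C K u v)" "y \<notin> pages C K u v"
    unfolding pages_def K'K using adj_u adj_v vy yK nuy by auto
  have card_pages: "card (pages C' K' u v) = Suc (card (pages C K u v))"
    unfolding pages(1) using pages(2) finite_pages[OF fin(1)] by simp
  obtain a b where ab: "a \<in> pages C K u v" "b \<in> pages C K u v" "a \<noteq> b"
    using s unfolding safe_spine_def spine_def by blast
  have no2: "pages C' K' u v \<noteq> {c, d}" for c d
  proof
    assume eq: "pages C' K' u v = {c, d}"
    have "y \<in> {c, d}" "a \<in> {c, d}" "b \<in> {c, d}" using eq pages ab by auto
    moreover have "y \<noteq> a" "y \<noteq> b" using pages ab by auto
    ultimately show False using ab by auto
  qed
  have half: "half_pages C' B K' u v \<subseteq> ?H - {y}"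
    unfolding half_pages_def K'K using adj_u adj_v vy yuv by auto
  have cH: "card ?H > 0"
    using yH finite_half_pages[OF fin(1)] by (auto simp: card_gt_0_iff)
  have safe: "safe_spine C' B' K' u v"
    if "2 * card (pages C K u v) + 2 + card (half_pages C' B' K' u v) \<le> 2 * (card K div 2)" for B'
    unfolding safe_spine_def using sp no2 uv that card_pages unfolding K'K by (auto simp: adj_insert)
  show ?thesis
  proof (cases "?H - {y} = {}")
    case True
    then have "half_pages C' B K' u v = {}" using half by blast
    then have "card (half_pages C' B K' u v) = 0" by simp
    \<comment> \<open>No half page besides \<open>y\<close> is left to spoil. The bound in
      \<open>J\<close> is even and an odd 1 is used up by \<open>y\<close>, so there is room for one
      more page.\<close>
    moreover have "card (pages C K u v) < card K div 2" using J cH by linarith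
    ultimately have "2 * card (pages C K u v) + 2 + card (half_pages C' B K' u v) \<le> 2 * (card K div 2)"
      by linarith
    then have "safe_spine C' B K' u v" by (rule safe)
    then show ?thesis using safeI[OF C4] by (auto simp: answerable_def)
  next
    case False
    then obtain z where z: "z \<in> ?H" "z \<noteq> y" by blast
    then have zK: "z \<in> K" "z \<noteq> u" "z \<noteq> v" by (auto simp: half_pages_def)
    have claim: answerable if r: "r \<in> {u, v}" "\<not> adj C' r z"
      and hz: "z \<notin> half_pages C' (insert {r, z} B) K' u v" for r
    proof (rule answerI[of r z])
      show "r \<in> K'" "z \<in> K'" "r \<noteq> z" "\<not> adj C' r z" using r zK in_K by auto
      have "half_pages C' (insert {r, z} B) K' u v \<subseteq> half_pages C' B K' u v"
        by (auto simp: half_pages_def adj_insert)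
      then have sub: "half_pages C' (insert {r, z} B) K' u v \<subseteq> ?H - {y} - {z}"
        using half hz by blast
      have "card (half_pages C' (insert {r, z} B) K' u v) \<le> card (?H - {y} - {z})"
        by (rule card_mono[OF _ sub]) (simp add: finite_half_pages fin)
      also have "\<dots> = card ?H - 2" using z yH finite_half_pages[OF fin(1)] by simp
      finally have "card (half_pages C' (insert {r, z} B) K' u v) \<le> card ?H - 2" .
      moreover have "card ?H \<ge> 2"
        using z yH card_mono[OF finite_half_pages[OF fin(1)], of "{y, z}" C B u v] by simp
      ultimately have "safe_spine C' (insert {r, z} B) K' u v"
        using J by (intro safe) linarith
      then show "structured C' (insert {r, z} B) K'" by (rule safeI[OF C4])
    qed
    from z(1) consider "adj C u z" "\<not> adj C v z" | "adj C v z" "\<not> adj C u z"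
      by (auto simp: half_pages_def)
    then show ?thesis
    proof cases
      case 1
      then show ?thesis using claim[of v] adj_u adj_v by (auto simp: half_pages_def adj_insert)
    next
      case 2
      then show ?thesis using claim[of u] adj_u adj_v z by (auto simp: half_pages_def adj_insert)
    qed
  qed
qed

lemma spine_update:
  assumes C4: "C4_in C' K'" and s: "safe_spine C B K u v" and sp: "spine C' K' u v" and x: "x \<in> {u, v}"
    and uv: "adj C u v"
  shows answerable
proof -
  have vu: "safe_spine C B K v u" "spine C' K' v u" "adj C v u"
    using s sp uv by (simp_all add: safe_spine_commute spine_commute adj_commute)
  show ?thesis
    using x spine_new_vertex[OF _ C4 s uv sp] spine_new_vertex[OF _ C4 vu(1,3,2)]
      spine_new_page[OF _ C4 s uv sp] spine_new_page[OF _ C4 vu(1,3,2)] by blast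
qed

text \<open>Two old pages and a further vertex keep \<open>u\<close>, \<open>v\<close> the spine
  after the move. If Constructor owns \<open>uv\<close>, a move touching the spine is answered by
  \<open>spine_update\<close>; a move off the spine would have to join the only two pages, a pair
  that Blocker already owns.\<close>

lemma large_C4:
  assumes C4: "C4_in C K" and large: "card K \<ge> 6"
  shows answerable
proof -
  obtain u v where s: "safe_spine C B K u v"
    using goodK C4 large by (auto simp: good_def structured_def)
  then have sp: "spine C K u v" by (simp add: safe_spine_def)
  have C4': "C4_in C' K'" by (rule C4_mono[OF C4])
  have large': "card K' \<ge> 6"
    using large card_mono[OF fin(3), of K] by auto
  obtain x1 x2 where x12: "x1 \<in> pages C K u v" "x2 \<in> pages C K u v" "x1 \<noteq> x2"
    using sp unfolding spine_def by blast
  have uv: "u \<in> K" "v \<in> K" "u \<noteq> v" using sp by (auto simp: spine_def)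
  have E: "adj C' u x1" "adj C' x1 v" "adj C' v x2" "adj C' x2 u" "adj C' v x1" "adj C' x1 u" "adj C' u x2" "adj C' x2 v"
    using x12 by (auto simp: pages_def adj_commute adjC')
  have D: "distinct [u, x1, v, x2]" using uv x12 irr E by (auto)
  obtain t where t: "t \<in> K" "t \<notin> {u, x1, v, x2}" using card_ge_6D[OF large] by blast
  then have "adj C u t \<or> adj C v t" using sp unfolding spine_def by blast
  then have "adj C' t u \<or> adj C' t v" by (auto simp: adj_commute adjC')
  then have sp': "spine C' K' u v"
  proof
    assume "adj C' t u"
    then show ?thesis
      using spine_if_attached(1)[OF K' large' free D _ irr E(1-4) t(2)] uv by blast
  next
    assume tv: "adj C' t v"
    have D': "distinct [v, x1, u, x2]" and t': "t \<notin> {v, x1, u, x2}" using D t by auto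
    have "spine C' K' v u"
      using spine_if_attached(1)[OF K' large' free D' _ irr E(5-8) t' tv] uv by blast
    then show ?thesis by (simp add: spine_commute)
  qed
  show ?thesis
  proof (cases "adj B u v")
    case True
    then have "safe_spine C' B K' u v" using sp' by (simp add: safe_spine_def)
    then show ?thesis using safeI[OF C4'] by (auto simp: answerable_def)
  next
    case False
    then have Cuv: "adj C u v" and pg: "\<And>a b. pages C K u v = {a, b} \<Longrightarrow> adj B a b"
      using s unfolding safe_spine_def by auto
    show ?thesis
    proof (cases "x \<in> {u, v}")
      case True
      then show ?thesis using spine_update[OF C4' s sp' _ Cuv] by blast
    next
      case xn: False
      then have KL: "K = L" using spine_merge(2)[OF _ uv(1,2) sp'] by blast
      show ?thesis
      proof (cases "y \<in> {u, v}")
        case True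
        have s': "safe_spine C B L u v" "C4_in (insert {y, x} C) (L \<union> K)" "spine (insert {y, x} C) (L \<union> K) u v"
          using s C4' sp' KL by (simp_all add: insert_commute)
        show ?thesis
          using blocker_turn.spine_update[OF swap s'(2,1,3) True Cuv] by (rule answerable_swap)
      next
        case yn: False
        have "pages C' K' u v = {x, y}"
        proof -
          have "adj C' x y" by (simp add: adjC')
          then show ?thesis using sp' xn yn K(2) L(2) unfolding spine_def by blast
        qed
        moreover have "pages C' K' u v = pages C K u v"
          using xn yn KL by (auto simp: pages_def adjC')
        ultimately show ?thesis using pg not_adj_xy by simp
      qed
    qed
  qed
qed

lemma spine_of_C4:
  assumes C4: "C4_in D M" "D \<subseteq> C'" "M \<subseteq> K'" and large: "card K' \<ge> 6"
  obtains u x1 v x2 where "distinct [u, x1, v, x2]" "u \<in> M" "x1 \<in> M" "v \<in> M" "x2 \<in> M"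
    "adj D u x1" "adj D x1 v" "adj D v x2" "adj D x2 u" "spine C' K' u v"
    "x1 \<in> pages C' K' u v" "x2 \<in> pages C' K' u v"
proof -
  have "card K' > 4" using large by simp
  then obtain u x1 v x2 t where D: "distinct [u, x1, v, x2]" and M: "u \<in> M" "x1 \<in> M" "v \<in> M" "x2 \<in> M"
    and E: "adj D u x1" "adj D x1 v" "adj D v x2" "adj D x2 u" and t: "t \<notin> {u, x1, v, x2}" "adj C' t u"
    using C4_attached[OF K' _ C4] by metis
  have E': "adj C' u x1" "adj C' x1 v" "adj C' v x2" "adj C' x2 u"
    using E adj_mono[OF C4(2)] by blast+
  have "u \<in> K'" using M C4 by blast
  note sp = spine_if_attached[OF K' large free D this irr E' t]
  show ?thesis using that[OF D M E sp] .
qed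

text \<open>The answer to a fresh book with two pages over an edge of Constructor. The 4 is twice
  the number of pages.\<close>

lemma safe_by_claim_pages:
  assumes C4: "C4_in C' K'" and sp: "spine C' K' u v" and uv: "adj C' u v"
    and pages: "pages C' K' u v = {x1, x2}" "x1 \<noteq> x2" and n: "\<not> adj C' x1 x2"
    and J: "4 + card (half_pages C' B K' u v) \<le> 2 * (card K' div 2)"
  shows answerable
proof (rule answerI[of x1 x2])
  show "x1 \<in> K'" "x2 \<in> K'" using pages by (auto simp: pages_def)
  have "half_pages C' (insert {x1, x2} B) K' u v \<subseteq> half_pages C' B K' u v"
    by (auto simp: half_pages_def adj_insert)
  then have "card (half_pages C' (insert {x1, x2} B) K' u v) \<le> card (half_pages C' B K' u v)"
    by (intro card_mono finite_half_pages fin)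
  moreover have "card (pages C' K' u v) = 2" using pages by simp
  moreover have "adj (insert {x1, x2} B) a b" if "pages C' K' u v = {a, b}" for a b
    using that pages by (auto simp: adj_insert doubleton_eq_iff)
  ultimately have "safe_spine C' (insert {x1, x2} B) K' u v"
    unfolding safe_spine_def using sp uv J by auto
  then show "structured C' (insert {x1, x2} B) K'" by (rule safeI[OF C4])
qed (use pages n in auto)

lemma half_pages_avoid: "half_pages C' B K' u v \<subseteq> K' - {u, v} - pages C' K' u v"
  by (auto simp: half_pages_def pages_def)

text \<open>The limit of six edges on the old five vertices rules out a third page and an edge
  between the two pages, as either would require seven edges. At most two of the six vertices can be
  half pages, so Blocker may claim the pair of pages.\<close>

lemma five_to_six:
  assumes C4: "C4_in C K" and small: "card K \<le> 5" and large: "card K' \<ge> 6"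
  shows answerable
proof -
  have KL: "K \<noteq> L" using small large by auto
  have dis: "K \<inter> L = {}" using KL K_L_cases by blast
  have C4': "C4_in C' K'" by (rule C4_mono[OF C4])
  have "C \<subseteq> C'" "K \<subseteq> K'" by auto
  then obtain u x1 v x2 where D: "distinct [u, x1, v, x2]" and in_K: "u \<in> K" "x1 \<in> K" "v \<in> K" "x2 \<in> K"
    and E: "adj C u x1" "adj C x1 v" "adj C v x2" "adj C x2 u" and sp: "spine C' K' u v"
    and x12: "x1 \<in> pages C' K' u v" "x2 \<in> pages C' K' u v"
    using spine_of_C4[OF C4 _ _ large] by metis
  have Ly: "L = {y}" and xuv: "x = u \<or> x = v" using spine_merge[OF KL in_K(1,3) sp] by auto
  have yK: "y \<notin> K" using dis L(2) by blast
  have cK: "card K' = Suc (card K)" unfolding Ly using yK fin by simp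
  then have k5: "card K = 5" "card K' = 6" using small large by auto
  have few: "card (edges_in C K) \<le> 6"
    using balanced_few_edges[OF CE BE CB fin(1)] k5 goodK by (auto simp: good_def)
  have adjE: "{a, b} \<in> edges_in C K" if "adj C a b" "a \<in> K" for a b
    using that component_closed[OF K(1) that(2,1)] by (auto simp: edges_in_def adj_def)
  have adjK: "adj C' a b \<longleftrightarrow> adj C a b" if "a \<in> K" "b \<in> K" for a b
    using that yK by (auto simp: adjC')
  show ?thesis
  proof (cases "adj C' u v")
    case False
    then show ?thesis using safe_by_claim_spine[OF C4' sp] by blast
  next
    case True
    then have uv: "adj C u v" using adjK in_K by blast
    have base: "{{u, v}, {u, x1}, {v, x1}, {u, x2}, {v, x2}} \<subseteq> edges_in C K"
      using adjE[OF uv in_K(1)] adjE[OF E(1) in_K(1)] adjE[OF E(2) in_K(2)] adjE[OF E(3) in_K(3)] adjE[OF E(4) in_K(4)]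
      by (simp add: insert_commute)
    have pg: "pages C' K' u v = {x1, x2}"
    proof (rule ccontr)
      assume "pages C' K' u v \<noteq> {x1, x2}"
      then obtain z where z: "z \<in> pages C' K' u v" "z \<noteq> x1" "z \<noteq> x2" using x12 by blast
      then have zadj: "adj C' u z" "adj C' v z" by (auto simp: pages_def)
      have "z \<noteq> y"
      proof
        assume "z = y"
        then have "u = x" "v = x" using zadj component_closed[OF K(1)] in_K yK unfolding adjC' by blast+
        then show False using D by simp
      qed
      then have "z \<in> K" using z Ly by (auto simp: pages_def)
      then have zC: "adj C u z" "adj C v z" using zadj adjK in_K by blast+
      have zuv: "z \<noteq> u" "z \<noteq> v" using zC irrC by auto
      have "{{u, v}, {u, x1}, {v, x1}, {u, x2}, {v, x2}, {u, z}, {v, z}} \<subseteq> edges_in C K"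
        using base adjE[OF zC(1) in_K(1)] adjE[OF zC(2) in_K(3)] by simp
      note card_mono[OF finite_edges_in[OF fin(1)] this]
      moreover have "distinct [u, v, x1, x2, z]" using D z zuv by auto
      ultimately show False using few card_7_edges(1)[of u v x1 x2 z] by linarith
    qed
    have nx: "\<not> adj C' x1 x2"
    proof
      assume "adj C' x1 x2"
      then have xx: "adj C x1 x2" using adjK in_K by blast
      have "card {u, x1, v, x2} \<le> 4" using card_length[of "[u, x1, v, x2]"] by simp
      then have "\<not> K \<subseteq> {u, x1, v, x2}" using k5 card_mono[of "{u, x1, v, x2}" K] by auto
      then obtain w where w: "w \<in> K" "w \<notin> {u, x1, v, x2}" by blast
      then have "adj C' u w \<or> adj C' v w" using sp unfolding spine_def by blast
      then have "adj C u w \<or> adj C v w" using adjK in_K w by blast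
      then show False
      proof
        assume a: "adj C u w"
        have "{{u, v}, {u, x1}, {v, x1}, {u, x2}, {v, x2}, {x1, x2}, {u, w}} \<subseteq> edges_in C K"
          using base adjE[OF xx in_K(2)] adjE[OF a in_K(1)] by simp
        note card_mono[OF finite_edges_in[OF fin(1)] this]
        moreover have "distinct [u, v, x1, x2, w]" using D w by auto
        ultimately show False using few card_7_edges(2)[of u v x1 x2 w] by linarith
      next
        assume a: "adj C v w"
        have "{{v, u}, {v, x1}, {u, x1}, {v, x2}, {u, x2}, {x1, x2}, {v, w}} \<subseteq> edges_in C K"
          using base adjE[OF xx in_K(2)] adjE[OF a in_K(3)] by (simp add: insert_commute)
        note card_mono[OF finite_edges_in[OF fin(1)] this]
        moreover have "distinct [v, u, x1, x2, w]" using D w by auto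
        ultimately show False using few card_7_edges(2)[of v u x1 x2 w] by linarith
      qed
    qed
    have "half_pages C' B K' u v \<subseteq> K' - {u, v, x1, x2}" using half_pages_avoid[of u v] pg by blast
    then have "card (half_pages C' B K' u v) \<le> card (K' - {u, v, x1, x2})"
      using fin by (intro card_mono) auto
    also have "\<dots> = 2" using in_K D k5 fin by (subst card_Diff_subset) auto
    finally show ?thesis
      using safe_by_claim_pages[OF C4' sp True pg _ nx] D k5 by auto
  qed
qed

text \<open>The edge \<open>xy\<close> is a bridge, and a bridge lies on no cycle.\<close>

lemma C4_not_across:
  assumes C4: "C4_in C' K'" and KL: "K \<noteq> L"
  shows "C4_in C K \<or> C4_in C L"
proof -
  have dis: "K \<inter> L = {}" using KL K_L_cases by blast
  obtain a b c d where in_K: "a \<in> K'" "b \<in> K'" "c \<in> K'" "d \<in> K'" and D: "distinct [a, b, c, d]"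
    and E: "adj C' a b" "adj C' b c" "adj C' c d" "adj C' d a"
    using C4 unfolding C4_in_def by blast
  have KK: "adj C p q" if "p \<in> K" "q \<in> K" "adj C' p q" for p q
    using that dis L(2) unfolding adjC' by blast
  have LL: "adj C p q" if "p \<in> L" "q \<in> L" "adj C' p q" for p q
    using that dis K(2) unfolding adjC' by blast
  have cr: "p = x \<and> q = y" if "p \<in> K" "q \<in> L" "adj C' p q" for p q
    using that dis component_closed[OF K(1)] L(2) unfolding adjC' by blast
  have cr': "p = y \<and> q = x" if "p \<in> L" "q \<in> K" "adj C' p q" for p q
    using cr[of q p] that by (simp add: adj_commute)
  have "a \<in> K \<and> b \<in> K \<and> c \<in> K \<and> d \<in> K \<or> a \<in> L \<and> b \<in> L \<and> c \<in> L \<and> d \<in> L"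
    using in_K E D cr[of a b] cr[of b c] cr[of c d] cr[of d a]
      cr'[of a b] cr'[of b c] cr'[of c d] cr'[of d a] by auto
  then show ?thesis
  proof
    assume *: "a \<in> K \<and> b \<in> K \<and> c \<in> K \<and> d \<in> K"
    have "C4_in C K" by (rule C4_inI[of a _ b c d]) (use * D E KK in auto)
    then show ?thesis ..
  next
    assume *: "a \<in> L \<and> b \<in> L \<and> c \<in> L \<and> d \<in> L"
    have "C4_in C L" by (rule C4_inI[of a _ b c d]) (use * D E LL in auto)
    then show ?thesis ..
  qed
qed

text \<open>Everything is read off from the absence of a 4-cycle before the move: if Constructor
  owns \<open>uv\<close>, the book has exactly two pages, not joined by her. The condition
  \<open>covered\<close> then excludes one vertex from becoming a page.\<close>

lemma new_C4:
  assumes KL: "K = L" and C4: "C4_in C' K'" and old: "\<not> C4_in C K" and large: "card K' \<ge> 6"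
  shows answerable
proof -
  have K'K: "K' = K" using KL by simp
  obtain u x1 v x2 where D: "distinct [u, x1, v, x2]" and in_K: "u \<in> K" "x1 \<in> K" "v \<in> K" "x2 \<in> K"
    and E: "adj C' u x1" "adj C' x1 v" "adj C' v x2" "adj C' x2 u" and sp: "spine C' K' u v"
    and x12: "x1 \<in> pages C' K' u v" "x2 \<in> pages C' K' u v"
    using spine_of_C4[OF C4 order_refl order_refl large] unfolding K'K by metis
  show ?thesis
  proof (cases "adj C' u v")
    case False
    then show ?thesis using safe_by_claim_spine[OF C4 sp] by blast
  next
    case uv': True
    have noC4: False if "distinct [a, b, c, d]" "a \<in> K" "b \<in> K" "c \<in> K" "d \<in> K"
      "adj C a b" "adj C b c" "adj C c d" "adj C d a" for a b c d
      using C4_inI[of a K b c d C] that old by blast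
    \<comment> \<open>The page whose edge to the spine is the new one. Two untouched pages would
      have formed a 4-cycle with \<open>u\<close> and \<open>v\<close> before the move, and only one
      page can be touched, so there are just two pages.\<close>
    define touched where "touched p \<longleftrightarrow> {x, y} = {u, p} \<or> {x, y} = {v, p}" for p
    have untouched: "adj C u p" "adj C v p" if "p \<in> pages C' K' u v" "\<not> touched p" for p
      using that by (auto simp: pages_def adjC' touched_def)
    have page_out: "p \<in> K" "p \<noteq> u" "p \<noteq> v" if "p \<in> pages C' K' u v" for p
      using that irr K'K by (auto simp: pages_def)
    have one: "p = q" if "touched p" "touched q" "p \<in> pages C' K' u v" "q \<in> pages C' K' u v" for p q
      using that page_out[of p] page_out[of q] unfolding touched_def by (auto simp: doubleton_eq_iff)
    have some: "touched p \<or> touched q"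
      if "p \<in> pages C' K' u v" "q \<in> pages C' K' u v" "p \<noteq> q" for p q
    proof (rule ccontr)
      assume n: "\<not> (touched p \<or> touched q)"
      show False
        using noC4[of u p v q] untouched[of p] untouched[of q] n that page_out[of p] page_out[of q] in_K D
        by (auto simp: adj_commute)
    qed
    have pg: "pages C' K' u v = {x1, x2}"
    proof (rule ccontr)
      assume "pages C' K' u v \<noteq> {x1, x2}"
      then obtain z where z: "z \<in> pages C' K' u v" "z \<noteq> x1" "z \<noteq> x2" using x12 by blast
      show False using some[of x1 x2] some[of x1 z] some[of x2 z] one[of x1 x2] one[of x1 z] one[of x2 z] x12 z D
        by auto
    qed
    have tou: "touched x1 \<or> touched x2" using some x12 D by auto
    then have uv: "adj C u v" using uv' page_out x12 D unfolding touched_def adjC' by (auto simp: doubleton_eq_iff)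
    have nx: "\<not> adj C' x1 x2"
    proof
      assume "adj C' x1 x2"
      then have xx: "adj C x1 x2" using tou D unfolding touched_def adjC' by (auto simp: doubleton_eq_iff)
      \<comment> \<open>The move supplied only one of the edges from \<open>p\<close> to the spine.
        The other, with the old edges \<open>pq\<close> and \<open>uv\<close> and an edge from
        \<open>q\<close> to the spine, closes a 4-cycle that existed earlier.\<close>
      have K4: False if "touched p" "{p, q} = {x1, x2}" for p q
      proof -
        have pq: "p \<in> pages C' K' u v" "q \<in> pages C' K' u v" "p \<noteq> q" "adj C p q"
          using that(2) x12 xx D by (auto simp: doubleton_eq_iff adj_commute)
        have "\<not> touched q" using one[of p q] pq that by blast
        then have q: "adj C u q" "adj C v q" using untouched pq by blast+
        have "adj C u p \<or> adj C v p"
          using pq(1) that(1) page_out[OF pq(1)] D unfolding touched_def pages_def adjC'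
          by (auto simp: doubleton_eq_iff)
        then show False
        proof
          assume "adj C u p"
          then show False
            using noC4[of u p q v] uv q pq page_out[of p] page_out[of q] in_K D by (auto simp: adj_commute)
        next
          assume "adj C v p"
          then show False
            using noC4[of v p q u] uv q pq page_out[of p] page_out[of q] in_K D by (auto simp: adj_commute)
        qed
      qed
      show False using tou K4[of x1 x2] K4[of x2 x1] by blast
    qed
    have "covered C B K" using goodK old by (simp add: good_def structured_def)
    then obtain p q where unc: "\<And>z. z \<in> K \<Longrightarrow> \<forall>w\<in>K. \<not> adj B z w \<Longrightarrow> z = p \<or> z = q"
      and com: "p \<noteq> q \<longrightarrow> (\<forall>w. \<not> (adj C p w \<and> adj C q w))"
      unfolding covered_def by blast
    \<comment> \<open>The untouched page is a common neighbour of \<open>u\<close> and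
      \<open>v\<close> before the move, so they cannot both be exceptions in \<open>covered\<close>.
      One of them has a Blocker edge to some \<open>w\<close>, which is therefore no half
      page.\<close>
    have "\<exists>w. adj C u w \<and> adj C v w"
      using one[of x1 x2] untouched x12 D by auto
    then have "\<not> (u = p \<and> v = q)" "\<not> (u = q \<and> v = p)" using com D by auto
    then have "\<not> ((\<forall>w\<in>K. \<not> adj B u w) \<and> (\<forall>w\<in>K. \<not> adj B v w))"
      using unc[OF in_K(1)] unc[OF in_K(3)] D by auto
    then obtain w where w: "w \<in> K" "adj B u w \<or> adj B v w" by blast
    have "adj C' v u" "adj C' v x1" "adj C' u x2" using uv' E by (simp_all add: adj_commute)
    then have wn: "w \<notin> {u, v, x1, x2}" using w(2) disj E uv' irrB by auto
    have "w \<notin> half_pages C' B K' u v"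
      using w disj by (auto simp: half_pages_def)
    then have "half_pages C' B K' u v \<subseteq> K' - {u, v, x1, x2, w}" using half_pages_avoid[of u v] pg by blast
    then have "card (half_pages C' B K' u v) \<le> card (K' - {u, v, x1, x2, w})"
      using fin by (intro card_mono) auto
    also have "\<dots> = card K' - 5" using in_K w wn D fin by (subst card_Diff_subset) (auto simp: numeral_eq_Suc)
    \<comment> \<open>The left side is at most \<open>card K' - 1\<close>, which fits below the
      bound for odd sizes too; this is what the vertex \<open>w\<close> is lost for.\<close>
    finally have "4 + card (half_pages C' B K' u v) \<le> 2 * (card K' div 2)" using large by presburger
    then show ?thesis
      using safe_by_claim_pages[OF C4 sp uv' pg _ nx] D by auto
  qed
qed

lemma answer_exists: answerable
proof (cases "C4_in C' K'")
  case False
  then show ?thesis using C4_free_merge C4_free_inside by blast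
next
  case C4: True
  show ?thesis
  proof (cases "card K' \<ge> 6")
    case False
    then show ?thesis using C4 by (simp add: answerable_def structured_def)
  next
    case large: True
    have large': "card (L \<union> K) \<ge> 6" using large by (simp add: Un_commute)
    consider "C4_in C K" | "C4_in C L" | "\<not> C4_in C K" "\<not> C4_in C L" by blast
    then show ?thesis
    proof cases
      case 1
      then show ?thesis using large_C4 five_to_six[OF _ _ large] by (cases "card K \<ge> 6") auto
    next
      case 2
      then show ?thesis
        using blocker_turn.large_C4[OF swap] blocker_turn.five_to_six[OF swap _ _ large'] answerable_swap
        by (cases "card L \<ge> 6") auto
    next
      case 3
      then show ?thesis using new_C4 C4_not_across C4 large by blast
    qed
  qed
qed

end

section \<open>Restoring the edge balance\<close>

context blocker_turn
begin

text \<open>When components merge, their halves rounded down add up to no more than the half of the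
  union. The new edge accounts for the extra 1, which an answer inside the component repays.\<close>

lemma card_edges_in_after_move:
  assumes "card K' \<le> 5"
  shows "card (edges_in C' K') \<le> card (edges_in B K') + card K' div 2 + 1"
proof (cases "K = L")
  case True
  then have "edges_in C' K' = insert {x, y} (edges_in C K)"
    using K(2) L(2) by (auto simp: edges_in_def)
  then have "card (edges_in C' K') \<le> card (edges_in C K) + 1"
    by (simp add: card_insert_if finite_edges_in fin)
  moreover have "card (edges_in C K) \<le> card (edges_in B K) + card K div 2"
    using goodK assms True by (simp add: good_def balanced_def)
  ultimately show ?thesis using True by simp
next
  case False
  then have dis: "K \<inter> L = {}" using K_L_cases by blast
  have card': "card K' = card K + card L" using fin dis by (simp add: card_Un_disjoint)
  have pair: "\<exists>a b. e = {a, b} \<and> adj C a b" if "e \<in> C" for e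
    using that CE unfolding edges_K_def adj_def by blast
  have split: "e \<subseteq> K \<or> e \<subseteq> L" if e: "e \<in> C" "e \<subseteq> K'" for e
  proof -
    obtain a b where ab: "e = {a, b}" "adj C a b" using pair e(1) by blast
    then show ?thesis
      using e(2) component_closed[OF K(1), of a b] component_closed[OF L(1), of a b] by blast
  qed
  have "edges_in C' K' \<subseteq> insert {x, y} (edges_in C K \<union> edges_in C L)"
    using split by (auto simp: edges_in_def)
  then have "card (edges_in C' K') \<le> card (insert {x, y} (edges_in C K \<union> edges_in C L))"
    by (intro card_mono) (auto simp: finite_edges_in fin)
  also have "\<dots> \<le> card (edges_in C K \<union> edges_in C L) + 1"
    by (simp add: card_insert_if finite_edges_in fin)
  also have "\<dots> \<le> card (edges_in C K) + card (edges_in C L) + 1" by (simp add: card_Un_le)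
  also have "\<dots> \<le> card (edges_in B K) + card K div 2 + (card (edges_in B L) + card L div 2) + 1"
    using goodK goodL assms card' by (simp add: good_def balanced_def add_mono)
  finally have 1: "card (edges_in C' K') \<le>
    card (edges_in B K) + card K div 2 + (card (edges_in B L) + card L div 2) + 1" .
  \<comment> \<open>A member of \<open>B\<close> inside both of the disjoint sets could only be
    empty, so no edge is counted twice.\<close>
  have "{} \<notin> B" using BE by (auto simp: edges_K_def)
  then have "edges_in B K \<inter> edges_in B L = {}"
    using dis by (auto simp: edges_in_def) (metis Int_greatest subset_empty)
  then have "card (edges_in B K) + card (edges_in B L) = card (edges_in B K \<union> edges_in B L)"
    by (intro card_Un_disjoint[symmetric] finite_edges_in fin)
  also have "\<dots> \<le> card (edges_in B K')"
    by (intro card_mono finite_edges_in fin) (auto simp: edges_in_def)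
  finally show ?thesis using 1 card' by linarith
qed

lemma balanced_after_claim:
  assumes "f \<subseteq> K'" "f \<notin> B"
  shows "balanced C' (insert f B) K'"
proof -
  have "edges_in (insert f B) K' = insert f (edges_in B K')" "f \<notin> edges_in B K'"
    using assms by (auto simp: edges_in_def)
  then have "card (edges_in (insert f B) K') = card (edges_in B K') + 1"
    by (simp add: finite_edges_in fin)
  then show ?thesis using card_edges_in_after_move unfolding balanced_def by linarith
qed

text \<open>If every pair inside the component is claimed, the numbers of edges of the two players add up to
  \<open>k choose 2\<close>, and the parity of this number saves the missing answer.\<close>

lemma balanced_if_full:
  assumes "{e. e \<subseteq> K' \<and> card e = 2} \<subseteq> C' \<union> B"
  shows "balanced C' B K'"
  unfolding balanced_def
proof
  assume small: "card K' \<le> 5"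
  have "C' \<inter> B = {}" using CB xy by auto
  have "{e. e \<subseteq> K' \<and> card e = 2} = edges_in C' K' \<union> edges_in B K'"
  proof (rule subset_antisym)
    show "{e. e \<subseteq> K' \<and> card e = 2} \<subseteq> edges_in C' K' \<union> edges_in B K'"
      using assms unfolding edges_in_def by blast
  qed (intro Un_least edges_in_subset_pairs[OF C'E] edges_in_subset_pairs[OF BE])
  then have "card K' choose 2 = card (edges_in C' K' \<union> edges_in B K')"
    using n_subsets[OF fin(3), of 2] by simp
  also have "\<dots> = card (edges_in C' K') + card (edges_in B K')"
    using \<open>C' \<inter> B = {}\<close> by (intro card_Un_disjoint finite_edges_in fin) (auto simp: edges_in_def)
  finally have sum: "card K' choose 2 = card (edges_in C' K') + card (edges_in B K')" .
  have "card {x, y} \<le> card K'" using K(2) L(2) fin by (intro card_mono) auto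
  then have "card K' = 2 \<or> card K' = 3 \<or> card K' = 4 \<or> card K' = 5" using small xny by auto
  then show "card (edges_in C' K') \<le> card (edges_in B K') + card K' div 2"
    using sum card_edges_in_after_move[OF small] by (auto simp: choose_two) presburger+
qed

text \<open>If the structure demands no answer, any unclaimed pair inside the component restores the
  balance; if none is left, the parity argument applies.\<close>

lemma good_response:
  "good C' B K' \<or> (\<exists>f\<in>edges_K n - (C' \<union> B). good C' (insert f B) K')"
proof -
  have pair: "{a, b} \<in> edges_K n" if "a \<in> K'" "b \<in> K'" "a \<noteq> b" for a b
    using that K'_less unfolding edges_K_def by (auto simp: subset_iff)
  consider a b where "a \<in> K'" "b \<in> K'" "a \<noteq> b" "\<not> adj C' a b" "\<not> adj B a b" "structured C' (insert {a, b} B) K'"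
    | "structured C' B K'"
    using answer_exists unfolding answerable_def by blast
  then show ?thesis
  proof cases
    case 1
    then have "good C' (insert {a, b} B) K'"
      unfolding good_def using balanced_after_claim[of "{a, b}"] by (simp add: adj_def)
    moreover have "{a, b} \<in> edges_K n - (C' \<union> B)" using 1 pair[of a b] by (auto simp: adj_def)
    ultimately show ?thesis by blast
  next
    case 2
    show ?thesis
    proof (cases "{e. e \<subseteq> K' \<and> card e = 2} \<subseteq> C' \<union> B")
      case True
      then show ?thesis using 2 balanced_if_full by (simp add: good_def)
    next
      case False
      then obtain f where f: "f \<subseteq> K'" "card f = 2" "f \<notin> C' \<union> B" by blast
      then have "f \<in> edges_K n" using pair unfolding card_2_iff by auto
      moreover have "good C' (insert f B) K'"
        unfolding good_def using balanced_after_claim f structured_mono[OF 2 _ fin(3)] by blast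
      ultimately show ?thesis using f by blast
    qed
  qed
qed

end

section \<open>The invariant throughout the game\<close>

definition blocker_inv :: "nat \<Rightarrow> nat set set \<Rightarrow> nat set set \<Rightarrow> bool" where
  "blocker_inv n C B \<longleftrightarrow> C \<subseteq> edges_K n \<and> B \<subseteq> edges_K n \<and> C \<inter> B = {} \<and> P6_free C \<and>
     (\<forall>K. component C K \<longrightarrow> good C B K)"

lemma good_insert_outside:
  assumes good: "good C B K" and xy: "x \<notin> K" "y \<notin> K"
  shows "good (insert {x, y} C) B K"
proof -
  let ?C = "insert {x, y} C"
  have adj: "adj ?C a b = adj C a b" if "a \<in> K" for a b
    using that xy by (auto simp: adj_insert)
  have "edges_in ?C K = edges_in C K" using xy by (auto simp: edges_in_def)
  then have bal: "balanced ?C B K" using good by (simp add: good_def balanced_def)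
  have C4: "C4_in ?C K \<longleftrightarrow> C4_in C K" 
    unfolding C4_in_def using adj by (simp cong: bex_cong)
  have cov: "covered ?C B K" if "covered C B K" using that adj unfolding covered_def by metis
  have safe: "safe_spine ?C B K u v" if s: "safe_spine C B K u v" for u v
  proof -
    have uv: "u \<in> K" "v \<in> K" using s by (auto simp: safe_spine_def spine_def)
    have pages: "pages ?C K u v = pages C K u v" using adj uv by (auto simp: pages_def)
    have half: "half_pages ?C B K u v = half_pages C B K u v" using adj uv by (auto simp: half_pages_def)
    have "spine ?C K u v" using s adj uv pages unfolding safe_spine_def spine_def by auto
    then show ?thesis using s adj uv pages half by (auto simp: safe_spine_def)
  qed
  have "structured ?C B K"
    using good cov safe unfolding good_def structured_def C4 by (cases "C4_in C K") (simp_all, blast)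
  then show ?thesis using bal by (simp add: good_def)
qed

lemma blocker_inv_mono:
  assumes "blocker_inv n C B" "f \<in> edges_K n - (C \<union> B)"
  shows "blocker_inv n C (insert f B)"
proof -
  have C: "C \<subseteq> edges_K n" "B \<subseteq> edges_K n" "C \<inter> B = {}" "P6_free C"
    and good: "\<And>K. component C K \<Longrightarrow> good C B K"
    using assms(1) unfolding blocker_inv_def by blast+
  have "good C (insert f B) K" if "component C K" for K
    using good_mono[OF good[OF that] subset_insertI] component_finite(1)[OF C(1) that] by blast
  then show ?thesis using assms(2) C unfolding blocker_inv_def by blast
qed

text \<open>In the first alternative no answer is required; if Blocker must move,
  \<open>blocker_inv_mono\<close> permits any edge.\<close>

lemma blocker_inv_step:
  assumes inv: "blocker_inv n C B" and e: "e \<in> constr_moves n C B"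
  shows "blocker_inv n (insert e C) B \<or>
    (\<exists>f\<in>edges_K n - (insert e C \<union> B). blocker_inv n (insert e C) (insert f B))"
proof -
  obtain x y where exy: "e = {x, y}" using e by (auto simp: constr_moves_def edges_K_def)
  have C: "C \<subseteq> edges_K n" and B: "B \<subseteq> edges_K n" and CB: "C \<inter> B = {}" using inv by (auto simp: blocker_inv_def)
  obtain K where K: "component C K" "x \<in> K" using component_exists by blast
  obtain L where L: "component C L" "y \<in> L" using component_exists by blast
  interpret blocker_turn n C B x y K L
    using inv e K L unfolding exy by unfold_locales (auto simp: blocker_inv_def constr_moves_def)
  have ext: "blocker_inv n C' B'" if B': "B \<subseteq> B'" "B' \<subseteq> edges_K n" "C' \<inter> B' = {}" "good C' B' K'" for B'
  proof -
    have "good C' B' M" if M: "component C' M" for M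
    proof (cases "x \<in> M")
      case True
      then have "M = K'" using component_unique[OF M K'] K(2) by blast
      then show ?thesis using B' by simp
    next
      case False
      note out = component_insert_other[OF M False]
      have "good C B M" using inv out by (simp add: blocker_inv_def)
      then show ?thesis
        using good_mono[OF good_insert_outside[OF _ False out(2)] B'(1)] component_finite(1)[OF C'E M] by blast
    qed
    then show ?thesis using B' C'E free unfolding blocker_inv_def by blast
  qed
  from good_response show ?thesis
  proof
    assume "good C' B K'"
    then show ?thesis using ext[of B] B CB xy unfolding exy by auto
  next
    assume "\<exists>f\<in>edges_K n - (C' \<union> B). good C' (insert f B) K'"
    then obtain f where f: "f \<in> edges_K n - (C' \<union> B)" "good C' (insert f B) K'" by blast
    then have "blocker_inv n C' (insert f B)" using ext[of "insert f B"] B CB xy by auto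
    then show ?thesis using f(1) unfolding exy by blast
  qed
qed

lemma num_triangles_eq: "num_triangles n C = card (triangles C {0..<n})"
  by (simp add: num_triangles_def triangles_def adj_def)

lemma blocker_inv_bound:
  assumes inv: "blocker_inv n C B"
  shows "2 * num_triangles n C \<le> n"
proof -
  have C: "C \<subseteq> edges_K n" "B \<subseteq> edges_K n" "C \<inter> B = {}" "P6_free C" using inv by (auto simp: blocker_inv_def)
  \<comment> \<open>Numbers from \<open>n\<close> on are singleton components and are left out of
    the sum.\<close>
  define \<K> where "\<K> = {K. component C K \<and> K \<inter> {0..<n} \<noteq> {}}"
  have sub: "K \<subseteq> {0..<n}" if "K \<in> \<K>" for K
    using that component_finite(2)[OF C(1)] by (fastforce simp: \<K>_def)
  have fin: "finite \<K>" by (rule finite_subset[of _ "Pow {0..<n}"]) (use sub in auto)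
  have finK: "finite K" if "K \<in> \<K>" for K using finite_subset[OF sub[OF that]] by simp
  have "triangles C {0..<n} \<subseteq> (\<Union>K\<in>\<K>. triangles C K)"
  proof
    fix T assume T: "T \<in> triangles C {0..<n}"
    then have "T \<noteq> {}" by (auto simp: triangles_def)
    then obtain a where a: "a \<in> T" by blast
    obtain K where K: "component C K" "a \<in> K" using component_exists by blast
    have "T \<subseteq> K"
    proof
      fix b assume "b \<in> T"
      then show "b \<in> K" using T a K component_closed[OF K] by (cases "a = b") (auto simp: triangles_def)
    qed
    then have "T \<in> triangles C K" using T by (auto simp: triangles_def)
    moreover have "K \<in> \<K>" using K T a by (auto simp: \<K>_def triangles_def)
    ultimately show "T \<in> (\<Union>K\<in>\<K>. triangles C K)" by blast
  qed
  then have "card (triangles C {0..<n}) \<le> card (\<Union>K\<in>\<K>. triangles C K)"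
    using fin finK by (intro card_mono) (auto simp: finite_triangles)
  also have "\<dots> \<le> (\<Sum>K\<in>\<K>. card (triangles C K))" by (rule card_UN_le[OF fin])
  finally have "2 * num_triangles n C \<le> (\<Sum>K\<in>\<K>. 2 * card (triangles C K))"
    by (simp add: num_triangles_eq sum_distrib_left[symmetric])
  also have "\<dots> \<le> (\<Sum>K\<in>\<K>. card K)"
    using good_triangle_bound[OF C(1-3) _ C(4)] inv
    by (intro sum_mono) (auto simp: \<K>_def blocker_inv_def)
  also have "\<dots> = card (\<Union>K\<in>\<K>. K)"
  proof (rule card_UN_disjoint[symmetric, OF fin])
    show "\<forall>K\<in>\<K>. finite K" using finK by blast
    show "\<forall>K\<in>\<K>. \<forall>L\<in>\<K>. K \<noteq> L \<longrightarrow> K \<inter> L = {}"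
      using component_unique unfolding \<K>_def by blast
  qed
  also have "\<dots> \<le> card {0..<n}" using sub by (intro card_mono) auto
  finally show ?thesis by simp
qed

lemma blocker_inv_initial: "blocker_inv n {} {}"
proof -
  have single: "\<exists>x. K = {x}" if K: "component {} K" for K
  proof -
    obtain x where "x \<in> K" using K by (auto simp: component_def)
    moreover have "closed_under {} {x}" by (simp add: closed_under_def adj_def)
    ultimately show ?thesis using component_minimal[OF K, of "{x}"] by auto
  qed
  have "good {} {} {x}" for x
    by (auto simp: good_def balanced_def structured_def covered_def edges_in_def C4_in_def adj_def)
  then have "good {} {} K" if "component {} K" for K using single[OF that] by auto
  moreover have "P6_free {}" unfolding contains_P6_iff by (simp add: adj_def)
  ultimately show ?thesis by (simp add: blocker_inv_def)
qed

lemma finite_constr_moves: "finite (constr_moves n C B)"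
  by (simp add: constr_moves_def)

text \<open>A round consists of two moves, so the fuel drops by two and strong induction is used.
  Any amount of fuel will do, because the triangle bound holds wherever play stops.\<close>

lemma blocker_inv_game_val:
  "blocker_inv n C B \<Longrightarrow> 2 * game_val k n C B True \<le> n"
proof (induction k arbitrary: C B rule: less_induct)
  case (less k)
  show ?case
  proof (cases k)
    case 0
    then show ?thesis using blocker_inv_bound[OF less.prems] by simp
  next
    case (Suc j)
    show ?thesis
    proof (cases "constr_moves n C B = {} \<or> edges_K n - (C \<union> B) = {}")
      case True
      then show ?thesis using blocker_inv_bound[OF less.prems] Suc by simp
    next
      case False
      have "2 * game_val j n (insert e C) B False \<le> n" if e: "e \<in> constr_moves n C B" for e
      proof -
        have step: "blocker_inv n (insert e C) B \<or>
          (\<exists>f\<in>edges_K n - (insert e C \<union> B). blocker_inv n (insert e C) (insert f B))"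
          by (rule blocker_inv_step[OF less.prems e])
        \<comment> \<open>The invariant may hold only after the answer, but the number of triangles
          does not depend on \<open>B\<close>. So the bound is valid already between the two
          moves.\<close>
        then have bound: "2 * num_triangles n (insert e C) \<le> n" using blocker_inv_bound by blast
        show ?thesis
        proof (cases j)
          case 0
          then show ?thesis using bound by simp
        next
          case (Suc i)
          let ?U = "edges_K n - (insert e C \<union> B)"
          show ?thesis
          proof (cases "constr_moves n (insert e C) B = {} \<or> ?U = {}")
            case True
            then show ?thesis using bound Suc by simp
          next
            case ongoing: False
            then obtain f where f: "f \<in> ?U" "blocker_inv n (insert e C) (insert f B)"
              using step blocker_inv_mono by blast
            have "game_val j n (insert e C) B False
                = Min ((\<lambda>f. game_val i n (insert e C) (insert f B) True) ` ?U)"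
              using ongoing Suc by simp
            also have "\<dots> \<le> game_val i n (insert e C) (insert f B) True"
              using f(1) by (intro Min_le) auto
            finally show ?thesis
              using less.IH[of i, OF _ f(2)] Suc \<open>k = Suc j\<close> by simp
          qed
        qed
      qed
      moreover have "game_val k n C B True
          = Max ((\<lambda>e. game_val j n (insert e C) B False) ` constr_moves n C B)"
        using False Suc by simp
      moreover have "Max ((\<lambda>e. game_val j n (insert e C) B False) ` constr_moves n C B)
          \<in> (\<lambda>e. game_val j n (insert e C) B False) ` constr_moves n C B"
        using False by (intro Max_in) (auto simp: finite_constr_moves)
      ultimately show ?thesis by auto
    qed
  qed
qed

lemma g_upper_bound: "2 * g_K3_P6 n \<le> n"
  unfolding g_K3_P6_def by (rule blocker_inv_game_val[OF blocker_inv_initial])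

section \<open>Constructor's strategy\<close>

lemma edges_KI: "u < n \<Longrightarrow> v < n \<Longrightarrow> u \<noteq> v \<Longrightarrow> {u, v} \<in> edges_K n"
  unfolding edges_K_def by blast

text \<open>The vertices below \<open>q\<close> are the centers.\<close>

definition windmills :: "nat \<Rightarrow> nat \<Rightarrow> nat set set \<Rightarrow> bool" where
  "windmills q n C \<longleftrightarrow> C \<subseteq> edges_K n \<and>
     (\<forall>c<q. \<forall>d<q. \<not> adj C c d) \<and>
     (\<forall>x\<ge>q. \<forall>c<q. \<forall>d<q. adj C c x \<longrightarrow> adj C d x \<longrightarrow> c = d) \<and>
     (\<forall>x\<ge>q. \<forall>y\<ge>q. \<forall>z\<ge>q. adj C x y \<longrightarrow> adj C x z \<longrightarrow> y = z) \<and>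
     (\<forall>x\<ge>q. \<forall>y\<ge>q. adj C x y \<longrightarrow> (\<exists>c<q. adj C c x \<and> adj C c y))"

lemma windmillsD:
  assumes "windmills q n C"
  shows "C \<subseteq> edges_K n"
    and "c < q \<Longrightarrow> d < q \<Longrightarrow> \<not> adj C c d"
    and "x \<ge> q \<Longrightarrow> c < q \<Longrightarrow> d < q \<Longrightarrow> adj C c x \<Longrightarrow> adj C d x \<Longrightarrow> c = d"
    and "x \<ge> q \<Longrightarrow> y \<ge> q \<Longrightarrow> z \<ge> q \<Longrightarrow> adj C x y \<Longrightarrow> adj C x z \<Longrightarrow> y = z"
    and "x \<ge> q \<Longrightarrow> y \<ge> q \<Longrightarrow> adj C x y \<Longrightarrow> \<exists>c<q. adj C c x \<and> adj C c y"
proof -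
  note W = assms[unfolded windmills_def]
  show "C \<subseteq> edges_K n" using W by (rule conjunct1)
  show "c < q \<Longrightarrow> d < q \<Longrightarrow> \<not> adj C c d"
    using conjunct1[OF conjunct2[OF W]] by blast
  show "x \<ge> q \<Longrightarrow> c < q \<Longrightarrow> d < q \<Longrightarrow> adj C c x \<Longrightarrow> adj C d x \<Longrightarrow> c = d"
    using conjunct1[OF conjunct2[OF conjunct2[OF W]]] by blast
  show "x \<ge> q \<Longrightarrow> y \<ge> q \<Longrightarrow> z \<ge> q \<Longrightarrow> adj C x y \<Longrightarrow> adj C x z \<Longrightarrow> y = z"
    using conjunct1[OF conjunct2[OF conjunct2[OF conjunct2[OF W]]]] by blast
  show "x \<ge> q \<Longrightarrow> y \<ge> q \<Longrightarrow> adj C x y \<Longrightarrow> \<exists>c<q. adj C c x \<and> adj C c y"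
    using conjunct2[OF conjunct2[OF conjunct2[OF conjunct2[OF W]]]] by blast
qed

text \<open>A center \<open>p\<close> cannot start a path \<open>p r s t\<close>: \<open>r\<close>
  and \<open>s\<close> are non-centers, so \<open>t\<close> is a center, and the common center of
  \<open>r\<close> and \<open>s\<close> would equal both \<open>p\<close> and \<open>t\<close>.
  Hence the first three vertices of a path on six vertices are non-centers, although
  \<open>b\<close> has at most one non-center neighbour.\<close>

lemma windmills_P6_free:
  assumes W: "windmills q n C"
  shows "P6_free C"
  unfolding contains_P6_iff
proof (intro notI, elim exE conjE)
  fix a b c d e f
  assume D: "distinct [a, b, c, d, e, f]"
    and E: "adj C a b" "adj C b c" "adj C c d" "adj C d e" "adj C e f"
  have no_center: "q \<le> p" if P: "adj C p r" "adj C r s" "adj C s t" "distinct [p, r, s, t]" for p r s t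
  proof (rule ccontr)
    assume "\<not> q \<le> p"
    then have p: "p < q" by simp
    have r: "q \<le> r" using windmillsD(2)[OF W p, of r] P by (meson not_le)
    have sr: "adj C s r" using P by (simp add: adj_commute)
    have s: "q \<le> s" using windmillsD(3)[OF W r p, of s] P sr by (auto simp: not_le[symmetric])
    have ts: "adj C t s" using P by (simp add: adj_commute)
    have t: "t < q" using windmillsD(4)[OF W s r, of t] P sr by (auto simp: not_le[symmetric])
    obtain k where k: "k < q" "adj C k r" "adj C k s" using windmillsD(5)[OF W r s] P by blast
    have "k = p" using windmillsD(3)[OF W r k(1) p k(2)] P by blast
    moreover have "k = t" using windmillsD(3)[OF W s k(1) t k(3) ts] .
    ultimately show False using P(4) by simp
  qed
  have "q \<le> a" "q \<le> b" "q \<le> c"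
    using no_center[of a b c d] no_center[of b c d e] no_center[of c d e f] D E by auto
  then show False using windmillsD(4)[OF W, of b a c] D E by (auto simp: adj_commute)
qed

lemma windmills_insert_leaf:
  assumes W: "windmills q n C" and x: "q \<le> x" "x < n" and c: "c < q" and free: "\<And>d. d < q \<Longrightarrow> \<not> adj C d x"
  shows "windmills q n (insert {c, x} C)"
proof -
  have lone: "\<not> adj C x z" if "q \<le> z" for z
    using windmillsD(5)[OF W x(1) that] free by blast
  have "{c, x} \<in> edges_K n" using x c by (intro edges_KI) auto
  moreover have nb: "adj (insert {c, x} C) a b \<longleftrightarrow> adj C a b" if "q \<le> a" "q \<le> b" for a b
    using that c by (auto simp: adj_insert)
  ultimately show ?thesis unfolding windmills_def
  proof (intro conjI allI impI)
    show "insert {c, x} C \<subseteq> edges_K n" using \<open>{c, x} \<in> edges_K n\<close> windmillsD(1)[OF W] by blast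
    show "\<not> adj (insert {c, x} C) a d" if "a < q" "d < q" for a d
      using windmillsD(2)[OF W that] that x by (auto simp: adj_insert)
    show "a = d" if "q \<le> z" "a < q" "d < q" "adj (insert {c, x} C) a z" "adj (insert {c, x} C) d z" for z a d
      using that windmillsD(3)[OF W that(1-3)] free x c by (auto simp: adj_insert)
    show "y = z" if "q \<le> t" "q \<le> y" "q \<le> z" "adj (insert {c, x} C) t y" "adj (insert {c, x} C) t z" for t y z
      using that windmillsD(4)[OF W that(1-3)] nb by blast
    show "\<exists>a<q. adj (insert {c, x} C) a t \<and> adj (insert {c, x} C) a y"
      if "q \<le> t" "q \<le> y" "adj (insert {c, x} C) t y" for t y
      using windmillsD(5)[OF W that(1,2)] nb that by (auto simp: adj_insert)
  qed
qed

lemma windmills_insert_blade: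
  assumes W: "windmills q n C" and xy: "q \<le> x" "q \<le> y" "x \<noteq> y" and c: "c < q" "adj C c x" "adj C c y"
    and free: "\<And>z. q \<le> z \<Longrightarrow> \<not> adj C x z" "\<And>z. q \<le> z \<Longrightarrow> \<not> adj C y z"
  shows "windmills q n (insert {x, y} C)"
proof -
  have "x < n" "y < n" using adj_less[OF windmillsD(1)[OF W]] c by blast+
  then have E: "{x, y} \<in> edges_K n" using xy by (intro edges_KI)
  have nb: "adj (insert {x, y} C) a b \<longleftrightarrow> adj C a b" if "a < q" for a b
    using that xy by (auto simp: adj_insert)
  have free': "\<not> adj C z x" "\<not> adj C z y" if "q \<le> z" for z
    using free[OF that] by (simp_all add: adj_commute)
  show ?thesis unfolding windmills_def
  proof (intro conjI allI impI)
    show "insert {x, y} C \<subseteq> edges_K n" using E windmillsD(1)[OF W] by blast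
    show "\<not> adj (insert {x, y} C) a d" if "a < q" "d < q" for a d
      using windmillsD(2)[OF W that] nb that by blast
    show "a = d" if "q \<le> z" "a < q" "d < q" "adj (insert {x, y} C) a z" "adj (insert {x, y} C) d z" for z a d
      using that windmillsD(3)[OF W that(1-3)] nb by blast
    show "s = z" if "q \<le> t" "q \<le> s" "q \<le> z" "adj (insert {x, y} C) t s" "adj (insert {x, y} C) t z" for t s z
      using that windmillsD(4)[OF W that(1-3)] free free' by (auto simp: adj_insert)
    show "\<exists>a<q. adj (insert {x, y} C) a t \<and> adj (insert {x, y} C) a s"
      if "q \<le> t" "q \<le> s" "adj (insert {x, y} C) t s" for t s
      using windmillsD(5)[OF W that(1,2)] nb that c by (auto simp: adj_insert)
  qed
qed

text \<open>This concerns the strategy and not the rules: Constructor may still have legal moves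
  that leave the windmill shape.\<close>

definition stuck :: "nat \<Rightarrow> nat \<Rightarrow> nat set set \<Rightarrow> nat set set \<Rightarrow> bool" where
  "stuck q n C B \<longleftrightarrow> (\<forall>e\<in>edges_K n - (C \<union> B). \<not> windmills q n (insert e C))"

text \<open>Charge each edge to a non-center end: \<open>f\<close> gives its edge to the center and
  \<open>g\<close> its edge to the partner. Where these do not exist the description operator
  returns something arbitrary, which only enlarges the covering set.\<close>

lemma card_windmills:
  assumes W: "windmills q n C"
  shows "card C \<le> 2 * n"
proof -
  define f where "f x = {THE c. c < q \<and> adj C c x, x}" for x
  define g where "g x = {x, THE y. q \<le> y \<and> adj C x y}" for x
  have f: "f x = {c, x}" if "q \<le> x" "c < q" "adj C c x" for c x
  proof -
    have "(THE c. c < q \<and> adj C c x) = c"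
      using that windmillsD(3)[OF W that(1)] by (intro the_equality) blast+
    then show ?thesis by (simp add: f_def)
  qed
  have g: "g x = {x, y}" if "q \<le> x" "q \<le> y" "adj C x y" for x y
  proof -
    have "(THE y. q \<le> y \<and> adj C x y) = y"
      using that windmillsD(4)[OF W that(1)] by (intro the_equality) blast+
    then show ?thesis by (simp add: g_def)
  qed
  have "C \<subseteq> f ` {0..<n} \<union> g ` {0..<n}"
  proof
    fix e assume e: "e \<in> C"
    then obtain x y where xy: "e = {x, y}" "x < n" "y < n"
      using windmillsD(1)[OF W] unfolding edges_K_def by blast
    then have A: "adj C x y" "adj C y x" using e by (auto simp: adj_def insert_commute)
    consider "q \<le> x" "q \<le> y" | "x < q" "q \<le> y" | "q \<le> x" "y < q"
      using windmillsD(2)[OF W, of x y] A by linarith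
    then show "e \<in> f ` {0..<n} \<union> g ` {0..<n}"
    proof cases
      case 1
      then show ?thesis using g[of x y] A xy by auto
    next
      case 2
      then show ?thesis using f[of y x] A xy by auto
    next
      case 3
      then have "e = f x" using f[of x y] A xy by auto
      then show ?thesis using xy by auto
    qed
  qed
  then have "card C \<le> card (f ` {0..<n} \<union> g ` {0..<n})" by (intro card_mono) auto
  also have "\<dots> \<le> card (f ` {0..<n}) + card (g ` {0..<n})" by (rule card_Un_le)
  also have "\<dots> \<le> n + n" using card_image_le[of "{0..<n}" f] card_image_le[of "{0..<n}" g] by simp
  finally show ?thesis by simp
qed

text \<open>Blocker has at most \<open>2 * n\<close> edges. Each vertex of \<open>U\<close> has no
  center and cost him \<open>q\<close> of them; the unmatched leaves \<open>F c\<close> form a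
  clique of his; the matched vertices \<open>M\<close> lie in triangles through a center, each of
  which contains at most two non-centers.\<close>

lemma stuck_bound:
  assumes W: "windmills q n C" and B: "B \<subseteq> edges_K n" "card B \<le> card C" and stuck: "stuck q n C B"
    and q: "q > 0"
  shows "real n - real q - 2 * real n / real q - real q * (2 * sqrt (real n) + 1) \<le> 2 * real (num_triangles n C)"
proof -
  have finB: "finite B" using B(1) finite_subset finite_edges_K by blast
  have cB: "card B \<le> 2 * n" using B(2) card_windmills[OF W] by simp
  define U where "U = {x \<in> {q..<n}. \<forall>c<q. \<not> adj C c x}"
  define F where "F c = {x \<in> {q..<n}. adj C c x \<and> (\<forall>z\<ge>q. \<not> adj C x z)}" for c
  define M where "M = {x \<in> {q..<n}. \<exists>z\<ge>q. adj C x z}"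
  define \<T> where "\<T> = {T \<in> triangles C {0..<n}. T \<inter> {0..<q} \<noteq> {}}"
  have finT: "finite (triangles C {0..<n})" by (simp add: finite_triangles)
  have U: "card U * q \<le> 2 * n"
  proof -
    have UB: "{c, x} \<in> B" if x: "x \<in> U" and c: "c < q" for x c
    proof (rule ccontr)
      assume "{c, x} \<notin> B"
      moreover have "{c, x} \<notin> C" using x c by (auto simp: U_def adj_def)
      moreover have "{c, x} \<in> edges_K n" using x c by (intro edges_KI) (auto simp: U_def)
      ultimately show False
        using stuck windmills_insert_leaf[OF W _ _ c, of x] x unfolding stuck_def U_def by auto
    qed
    \<comment> \<open>Centers are below \<open>q\<close> and vertices of \<open>U\<close> are not,
      so the unordered pair reveals which end is which.\<close>
    have "inj_on (\<lambda>(x, c). {c, x}) (U \<times> {0..<q})"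
      by (auto simp: inj_on_def U_def doubleton_eq_iff)
    then have "card U * q = card ((\<lambda>(x, c). {c, x}) ` (U \<times> {0..<q}))"
      by (simp add: card_image card_cartesian_product)
    also have "\<dots> \<le> card B" using UB by (intro card_mono finB) auto
    finally show ?thesis using cB by simp
  qed
  have F: "real (card (F c)) \<le> 2 * sqrt n + 1" if c: "c < q" for c
  proof -
    have FB: "{x, y} \<in> B" if xy: "x \<in> F c" "y \<in> F c" "x \<noteq> y" for x y
    proof (rule ccontr)
      assume nB: "{x, y} \<notin> B"
      have "{x, y} \<notin> C" using xy by (auto simp: F_def adj_def)
      moreover have "{x, y} \<in> edges_K n" using xy by (intro edges_KI) (auto simp: F_def)
      moreover have "windmills q n (insert {x, y} C)"
        using xy by (intro windmills_insert_blade[OF W _ _ _ c]) (auto simp: F_def)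
      ultimately show False using stuck nB unfolding stuck_def by blast
    qed
    have "{e. e \<subseteq> F c \<and> card e = 2} \<subseteq> B"
    proof
      fix e assume "e \<in> {e. e \<subseteq> F c \<and> card e = 2}"
      then obtain x y where "e = {x, y}" "x \<noteq> y" "{x, y} \<subseteq> F c" unfolding card_2_iff by blast
      then show "e \<in> B" using FB by simp
    qed
    then have "card {e. e \<subseteq> F c \<and> card e = 2} \<le> 2 * n"
      using card_mono[OF finB, of "{e. e \<subseteq> F c \<and> card e = 2}"] cB by simp
    moreover have "finite (F c)" by (simp add: F_def)
    ultimately have "card (F c) choose 2 \<le> 2 * n" using n_subsets[of "F c" 2] by simp
    \<comment> \<open>Evenness makes the division by 2 in the binomial coefficient exact.\<close>
    moreover have "even (card (F c) * (card (F c) - 1))" by (cases "card (F c)") auto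
    ultimately have "card (F c) * (card (F c) - 1) \<le> 4 * n" unfolding choose_two by (elim evenE) simp
    then have "(card (F c) - 1) ^ 2 \<le> 4 * n"
      unfolding power2_eq_square by (meson diff_le_self le_trans mult_le_mono1)
    then have "real (card (F c) - 1) ^ 2 \<le> 4 * real n"
      by (metis of_nat_le_iff of_nat_mult of_nat_numeral of_nat_power)
    then have "real (card (F c) - 1) \<le> sqrt (4 * real n)" by (rule real_le_rsqrt)
    also have "\<dots> = 2 * sqrt n" by (simp add: real_sqrt_mult)
    finally show ?thesis by linarith
  qed
  have MT: "card M \<le> 2 * card \<T>"
  proof -
    have "M \<subseteq> (\<Union>T\<in>\<T>. T - {0..<q})"
    proof
      fix x assume "x \<in> M"
      then obtain z where z: "q \<le> x" "x < n" "q \<le> z" "adj C x z" by (auto simp: M_def)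
      obtain c where c: "c < q" "adj C c x" "adj C c z" using windmillsD(5)[OF W z(1,3,4)] by blast
      have "z < n" using adj_less[OF windmillsD(1)[OF W] z(4)] by blast
      have "x \<noteq> z" using adj_irrefl[OF windmillsD(1)[OF W]] z(4) by blast
      then have "card {c, x, z} = 3" using z c by simp
      then have "{c, x, z} \<in> triangles C {0..<n}"
        using z c \<open>z < n\<close> by (auto simp: triangles_def adj_commute)
      then have "{c, x, z} \<in> \<T>" using c by (simp add: \<T>_def)
      then show "x \<in> (\<Union>T\<in>\<T>. T - {0..<q})" using z by (intro UN_I[of "{c, x, z}"]) auto
    qed
    moreover have T2: "card (T - {0..<q}) \<le> 2 \<and> finite T" if T: "T \<in> \<T>" for T
    proof -
      obtain c where c: "c \<in> T" "c < q" using T by (auto simp: \<T>_def)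
      have T3: "card T = 3" using T by (auto simp: \<T>_def triangles_def)
      then have finT: "finite T" using card.infinite by fastforce
      have "card (T - {0..<q}) \<le> card (T - {c})" using c finT by (intro card_mono) auto
      then show ?thesis using c T3 finT by simp
    qed
    moreover have finT': "finite \<T>" using finT by (simp add: \<T>_def)
    ultimately have "card M \<le> card (\<Union>T\<in>\<T>. T - {0..<q})" by (intro card_mono) auto
    also have "\<dots> \<le> (\<Sum>T\<in>\<T>. card (T - {0..<q}))" by (rule card_UN_le[OF finT'])
    also have "\<dots> \<le> (\<Sum>T\<in>\<T>. 2)" using T2 by (intro sum_mono) blast
    finally show ?thesis by simp
  qed
  have "card \<T> \<le> num_triangles n C"
    unfolding num_triangles_eq \<T>_def by (intro card_mono finT) auto
  have cover: "{q..<n} \<subseteq> U \<union> (\<Union>c<q. F c) \<union> M"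
    by (auto simp: U_def F_def M_def)
  have "n - q \<le> card (U \<union> (\<Union>c<q. F c) \<union> M)"
    using card_mono[OF _ cover] by (simp add: U_def F_def M_def)
  also have "\<dots> \<le> card U + card (\<Union>c<q. F c) + card M"
    by (meson card_Un_le add_le_mono1 le_trans)
  also have "\<dots> \<le> card U + (\<Sum>c<q. card (F c)) + card M"
    by (simp add: card_UN_le)
  finally have "real (n - q) \<le> real (card U) + (\<Sum>c<q. real (card (F c))) + real (card M)"
    by (metis of_nat_le_iff of_nat_add of_nat_sum)
  moreover have "real n - q \<le> real (n - q)" by linarith
  moreover have "(\<Sum>c<q. real (card (F c))) \<le> (\<Sum>c<q. 2 * sqrt n + 1)" using F by (intro sum_mono) auto
  moreover have "(\<Sum>c<q. 2 * sqrt n + 1) = q * (2 * sqrt n + 1)" by simp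
  moreover have "real (card U) \<le> 2 * n / q"
  proof -
    have "real (card U) * q \<le> 2 * n" using U by (metis of_nat_le_iff of_nat_mult)
    then show ?thesis using q by (simp add: field_simps)
  qed
  moreover have "real (card M) \<le> 2 * real (num_triangles n C)"
    using MT \<open>card \<T> \<le> num_triangles n C\<close> by linarith
  ultimately show ?thesis by linarith
qed

section \<open>Playing the windmill strategy\<close>

lemma num_triangles_mono:
  assumes "C \<subseteq> D" shows "num_triangles n C \<le> num_triangles n D"
  unfolding num_triangles_eq
proof (rule card_mono)
  show "triangles C {0..<n} \<subseteq> triangles D {0..<n}"
    using adj_mono[OF assms] by (auto simp: triangles_def)
qed (simp add: finite_triangles)

text \<open>Constructor's graph only grows, so triangles are never lost, and once stuck the rest of
  the play may be arbitrary.\<close>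

lemma num_triangles_le_game_val: "num_triangles n C \<le> game_val k n C B t"
proof (induction k arbitrary: C B t)
  case (Suc k)
  show ?case
  proof (cases "constr_moves n C B = {} \<or> edges_K n - (C \<union> B) = {}")
    case False
    show ?thesis
    proof (cases t)
      case True
      obtain e where e: "e \<in> constr_moves n C B" using False by blast
      have "num_triangles n C \<le> num_triangles n (insert e C)" by (intro num_triangles_mono) auto
      also have "\<dots> \<le> game_val k n (insert e C) B False" by (rule Suc)
      also have "\<dots> \<le> Max ((\<lambda>e. game_val k n (insert e C) B False) ` constr_moves n C B)"
        using e by (intro Max_ge) (auto simp: finite_constr_moves)
      finally show ?thesis using False True by simp
    next
      case t: False
      have "num_triangles n C \<le> Min ((\<lambda>f. game_val k n C (insert f B) True) ` (edges_K n - (C \<union> B)))"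
        using False Suc by (intro Min.boundedI) auto
      then show ?thesis using False t by simp
    qed
  qed simp
qed simp

text \<open>The fuel is at least the number of unclaimed edges, so it cannot run out before the
  strategy is stuck. Blocker never has more edges than Constructor when she is to move, which keeps
  the estimate on \<open>B\<close> alive.\<close>

lemma windmills_game_val:
  assumes stuck: "\<And>C B. windmills q n C \<Longrightarrow> B \<subseteq> edges_K n \<Longrightarrow> card B \<le> card C \<Longrightarrow> stuck q n C B \<Longrightarrow>
      m \<le> num_triangles n C"
    and "windmills q n C" "B \<subseteq> edges_K n" "card B \<le> card C" "card (edges_K n - (C \<union> B)) \<le> k"
  shows "m \<le> game_val k n C B True"
  using assms(2-)
proof (induction k arbitrary: C B rule: less_induct)
  case (less k)
  show ?case
  proof (cases "stuck q n C B")
    case True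
    then show ?thesis
      using stuck[OF less.prems(1-3)] num_triangles_le_game_val[of n C k B True] by linarith
  next
    case False
    then obtain e where e: "e \<in> edges_K n - (C \<union> B)" "windmills q n (insert e C)"
      unfolding stuck_def by blast
    let ?C = "insert e C" and ?U = "edges_K n - (C \<union> B)" and ?V = "edges_K n - (insert e C \<union> B)"
    have fin: "finite C" "finite B"
      using windmillsD(1)[OF less.prems(1)] less.prems(2) finite_subset[OF _ finite_edges_K] by blast+
    have e_move: "e \<in> constr_moves n C B"
      using e windmills_P6_free[OF e(2)] by (simp add: constr_moves_def)
    have "card ?U > 0" using e by (auto simp: card_gt_0_iff)
    then obtain j where j: "k = Suc j" using less.prems(4) by (cases k) auto
    have "?V = ?U - {e}" by auto
    then have cV: "Suc (card ?V) = card ?U" using e \<open>card ?U > 0\<close> by simp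
    have cC: "card ?C = Suc (card C)" using e fin by simp
    have "m \<le> game_val j n ?C B False"
    proof (cases "stuck q n ?C B")
      case True
      then show ?thesis
        using stuck[OF e(2) less.prems(2)] cC less.prems(3) num_triangles_le_game_val[of n ?C j B False]
        by linarith
    next
      case False
      \<comment> \<open>Besides its role in the strategy, \<open>e'\<close> certifies that the game
        is not over after the move \<open>e\<close>, so the value is a minimum over Blocker's
        moves.\<close>
      then obtain e' where e': "e' \<in> ?V" "windmills q n (insert e' ?C)"
        unfolding stuck_def by blast
      have e'_move: "e' \<in> constr_moves n ?C B"
        using e' windmills_P6_free[OF e'(2)] by (simp add: constr_moves_def)
      have "card ?V > 0" using e' by (auto simp: card_gt_0_iff)
      then obtain i where i: "j = Suc i" using less.prems(4) cV j by (cases j) auto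
      have "m \<le> game_val i n ?C (insert f B) True" if f: "f \<in> ?V" for f
      proof (rule less.IH)
        show "i < k" using i j by simp
        show "windmills q n ?C" by (rule e(2))
        show "insert f B \<subseteq> edges_K n" using f less.prems(2) by blast
        show "card (insert f B) \<le> card ?C" using f fin cC less.prems(3) by simp
        have "edges_K n - (?C \<union> insert f B) = ?V - {f}" by auto
        then have "Suc (card (edges_K n - (?C \<union> insert f B))) = card ?V"
          using f \<open>card ?V > 0\<close> by simp
        then show "card (edges_K n - (?C \<union> insert f B)) \<le> i" using less.prems(4) cV i j by linarith
      qed
      then have "m \<le> Min ((\<lambda>f. game_val i n ?C (insert f B) True) ` ?V)"
        using e'(1) by (intro Min.boundedI) auto
      then show ?thesis using i e'(1) e'_move by auto
    qed
    also have "\<dots> \<le> Max ((\<lambda>e. game_val j n (insert e C) B False) ` constr_moves n C B)"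
      using e_move by (intro Max_ge) (auto simp: finite_constr_moves)
    finally show ?thesis using j e(1) e_move by auto
  qed
qed

section \<open>The explicit lower bound and the asymptotics\<close>

lemma g_lower_bound:
  fixes q n :: nat
  assumes "q > 0"
  shows "real n - real q - 2 * real n / real q - real q * (2 * sqrt (real n) + 1) \<le> 2 * real (g_K3_P6 n)"
proof -
  let ?r = "real n - real q - 2 * real n / real q - real q * (2 * sqrt (real n) + 1)"
  \<comment> \<open>The strategy lemma compares with a natural number. The integer part loses
    nothing for an integral score, and a negative bound becomes 0.\<close>
  have "nat \<lceil>?r / 2\<rceil> \<le> g_K3_P6 n"
    unfolding g_K3_P6_def
  proof (rule windmills_game_val[where q = q])
    fix C B assume "windmills q n C" "B \<subseteq> edges_K n" "card B \<le> card C" "stuck q n C B"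
    from stuck_bound[OF this assms] have "?r / 2 \<le> real (num_triangles n C)" by simp
    then show "nat \<lceil>?r / 2\<rceil> \<le> num_triangles n C" by (simp only: nat_le_iff ceiling_le_iff of_int_of_nat_eq)
  qed (auto simp: windmills_def adj_def)
  then have "?r / 2 \<le> real (g_K3_P6 n)" by (simp only: nat_le_iff ceiling_le_iff of_int_of_nat_eq)
  then show ?thesis by simp
qed

theorem theorem1p2:
  shows "(\<lambda>n. real (g_K3_P6 n)) \<sim>[at_top] (\<lambda>n. real n / 2)"
proof (rule asymp_equivI', rule tendsto_sandwich)
  \<comment> \<open>This exponent balances the errors: both \<open>2 * n / q\<close> and
    \<open>q * (2 * sqrt n + 1)\<close> are of order \<open>n powr (3 / 4)\<close>.\<close>
  let ?s = "\<lambda>n. real n powr (1 / 4)"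
  let ?l = "\<lambda>n. (real n - (?s n + 1) - 2 * n / ?s n - (?s n + 1) * (2 * sqrt n + 1)) / n"
  show "?l \<longlonglongrightarrow> 1" by real_asymp
  show "\<forall>\<^sub>F n in at_top. ?l n \<le> real (g_K3_P6 n) / (real n / 2)"
    using eventually_gt_at_top[of 0]
  proof eventually_elim
    case (elim n)
    \<comment> \<open>Rounding up puts \<open>q\<close> between \<open>?s n\<close> and
      \<open>?s n + 1\<close>. In \<open>?l\<close> the smaller value stands in the denominator and
      the larger one wherever \<open>q\<close> increases the error.\<close>
    define q where "q = nat \<lceil>?s n\<rceil>"
    have s: "?s n > 0" using elim by simp
    have q: "?s n \<le> q" "q \<le> ?s n + 1" "q > 0" using s unfolding q_def by linarith+
    have "real q > 0" using q s by linarith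
    then have "2 * real n / real q \<le> 2 * real n / ?s n"
      by (intro divide_left_mono[OF q(1)] mult_pos_pos s) simp
    moreover have "q * (2 * sqrt n + 1) \<le> (?s n + 1) * (2 * sqrt n + 1)" using q by (intro mult_right_mono) auto
    ultimately have "real n - (?s n + 1) - 2 * n / ?s n - (?s n + 1) * (2 * sqrt n + 1) \<le> 2 * real (g_K3_P6 n)"
      using g_lower_bound[OF q(3), of n] q(2) by linarith
    then have "?l n \<le> 2 * g_K3_P6 n / n" by (intro divide_right_mono) auto
    then show ?case by (simp add: mult.commute)
  qed
  show "\<forall>\<^sub>F n in at_top. real (g_K3_P6 n) / (real n / 2) \<le> 1"
    using eventually_gt_at_top[of 0]
  proof eventually_elim
    case (elim n)
    have "2 * real (g_K3_P6 n) \<le> n" using g_upper_bound[of n] by linarith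
    then show ?case using elim by (simp add: field_simps)
  qed
qed auto

end
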